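(* For every integer $k\ge 1$ there exists an algebraic $\mathbb{Z}^2$-action $\alpha$ that is mixing of order $k$ but not mixing of order $k+1$.
   Context: An algebraic $\mathbb{Z}^2$-action is a $\mathbb{Z}^2$-action $\alpha:\mathbf{n}\mapsto\alpha^{\mathbf{n}}$ by continuous automorphisms of a non-trivial compact metrizable abelian group $X$, equipped with Haar probability measure $\mu$ on its Borel $\sigma$-algebra $\mathcal{S}$. For $r\ge1$, the action $\alpha$ is mixing of order $r$ (also called $r$-fold mixing) if for every sequence $(\mathbf{n}_1^{(j)},\dots,\mathbf{n}_r^{(j)})_{j\ge1}$ of $r$-tuples of elements of $\mathbb{Z}^2$ with $\mathbf{n}_s^{(j)}-\mathbf{n}_t^{(j)}\to\infty$ as $j\to\infty$ for every $s\neq t$, and for all $A_1,\dots,A_r\in\mathcal{S}$, $$\lim_{j\to\infty}\mu\left(\alpha^{-\mathbf{n}_1^{(j)}}(A_1)\cap\dots\cap\alpha^{-\mathbf{n}_r^{(j)}}(A_r)\right)=\mu(A_1)\cdots\mu(A_r).$$ *)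

theory Defs
  imports "HOL-Probability.Probability" "HOL-Algebra.Group"
begin

locale compact_metrizable_abelian_group = comm_group G
  for G :: "('a, 'b) monoid_scheme" (structure) and T :: "'a topology" +
  assumes topspace_eq: "topspace T = carrier G"
    and continuous_mult: "continuous_map (prod_topology T T) T (\<lambda>(x, y). x \<otimes> y)"
    and continuous_inv: "continuous_map T T (\<lambda>x. inv x)"
    and compact: "compact_space T"
    and metrizable: "metrizable_space T"

locale algebraic_Z2_action = compact_metrizable_abelian_group G T
  for G :: "('a, 'b) monoid_scheme" (structure) and T :: "'a topology" +
  fixes \<alpha> :: "int \<times> int \<Rightarrow> 'a \<Rightarrow> 'a"
  assumes nontrivial: "carrier G \<noteq> {\<one>}"
    and automorphism: "\<alpha> n \<in> iso G G"
    and continuous: "continuous_map T T (\<alpha> n)"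
    and action_zero: "x \<in> carrier G \<Longrightarrow> \<alpha> 0 x = x"
    and action_add: "x \<in> carrier G \<Longrightarrow> \<alpha> (m + n) x = \<alpha> m (\<alpha> n x)"

text \<open>Regularity is not required below: every Borel probability measure on a compact
  metrizable space is regular. Hence this determines \<open>M\<close> uniquely when \<open>T\<close> is the topology
  of a compact metrizable group \<open>G\<close>.\<close>

definition haar_probability ::
    "('a, 'b) monoid_scheme \<Rightarrow> 'a topology \<Rightarrow> 'a measure \<Rightarrow> bool" where
  "haar_probability G T M \<longleftrightarrow>
     prob_space M \<and>
     sets M = sets (sigma (topspace T) {U. openin T U}) \<and>
     (\<forall>g\<in>carrier G. \<forall>A\<in>sets M. measure M ((\<lambda>x. g \<otimes>\<^bsub>G\<^esub> x) ` A) = measure M A)"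

text \<open>Used only for \<open>r \<ge> 1\<close>. Divergence to infinity in the discrete group
  \<open>\<int> \<times> \<int>\<close> is eventual escape from every finite set, i.e. convergence along \<open>cofinite\<close>.\<close>

definition mixing_of_order ::
    "nat \<Rightarrow> 'a measure \<Rightarrow> (int \<times> int \<Rightarrow> 'a \<Rightarrow> 'a) \<Rightarrow> bool" where
  "mixing_of_order r M \<alpha> \<longleftrightarrow>
     (\<forall>(n :: nat \<Rightarrow> nat \<Rightarrow> int \<times> int) (A :: nat \<Rightarrow> 'a set).
        (\<forall>s\<in>{1..r}. \<forall>t\<in>{1..r}. s \<noteq> t \<longrightarrow>
           filterlim (\<lambda>j. n s j - n t j) cofinite sequentially) \<longrightarrow>
        (\<forall>s\<in>{1..r}. A s \<in> sets M) \<longrightarrow>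
        (\<lambda>j. measure M (\<Inter>s\<in>{1..r}. \<alpha> (- n s j) ` A s))
          \<longlonglongrightarrow> (\<Prod>s\<in>{1..r}. measure M (A s)))"

text \<open>A compact metrizable space has at most continuum many points, so up to isomorphism every
  compact metrizable group has its carrier inside any fixed type of that cardinality. This is
  such a type; the topology \<open>T\<close> and the group structure on a carrier are arbitrary.\<close>

type_synonym point = "int \<times> int \<Rightarrow> int"

end

theory Submission
  imports Defs "HOL-Library.Z2" "HOL-Computational_Algebra.Formal_Laurent_Series"
begin

text \<open>
  Over the field with two elements consider the polynomial
  \<open>f(u, V) = \<Sum>j\<le>k. u^(e j) * V^j\<close> whose exponent sequence \<open>e\<close> is strictly concave on
  \<open>{0..k}\<close> with \<open>e 0 = 1\<close>, \<open>e k = 0\<close> and all other values positive. The group of the action is the dual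
  of the ring generated by \<open>u\<close>, \<open>v\<close> and their inverses, where \<open>v\<close> is a root of \<open>f\<close>; an element
  \<open>(a, b)\<close> of \<open>\<int> \<times> \<int>\<close> acts dually to multiplication by \<open>u^a * v^b\<close>. In this duality a
  character of the group is an element of the ring, it has Haar integral zero unless that element
  is zero, and so mixing of order \<open>r\<close> says that a sum of \<open>r\<close> ring elements, not all of them zero,
  stays nonzero once these are multiplied by monomials that are far apart.

  The action is not mixing of order \<open>k + 1\<close>: raising \<open>f(u, v) = 0\<close> to the power \<open>2^m\<close> gives a
  vanishing sum of \<open>k + 1\<close> monomials whose mutual distances tend to infinity with \<open>m\<close>
  (\<open>not_mixing_of_order_if_relation\<close>).

  It is mixing of order \<open>k\<close> because of the \<open>k\<close> edges of the Newton polygon of \<open>f\<close> that face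
  \<open>u = \<infinity>\<close>. Concavity makes them \<open>k\<close> edges with distinct slopes, each of height one, so Hensel's
  argument yields \<open>k\<close> roots of \<open>f\<close> among the Laurent series in \<open>1/u\<close>, with distinct valuations
  (\<open>mixing_poly_root\<close>). As \<open>f\<close> is irreducible (an Eisenstein argument at \<open>u = 0\<close>), each of these roots
  gives an embedding of the ring, hence a valuation on it. In a vanishing sum the least valuation is
  attained at least twice, for each of the \<open>k\<close> valuations. Thus every edge direction is, up to a
  bounded error, the direction of the segment joining two of the points \<open>n s\<close> by which the summands are
  shifted, and this segment lies on the boundary of their convex hull. The upper endpoints of
  these segments are distinct for distinct edges, and none of them is a lowest point, so that at
  least \<open>k + 1\<close> points are needed
  (\<open>edges_need_points\<close>, \<open>few_far_monomials_independent\<close>).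

  The passage from characters to arbitrary Borel sets is made in one slot at a time with the
  \<open>\<pi>\<close>-\<open>\<lambda>\<close> theorem (\<open>indicator_limit_from_characters\<close>, \<open>mixing_of_order_if_independent\<close>).
\<close>

unbundle no vec_syntax

section \<open>Laurent series over the field with two elements\<close>

lemma fls_bit_add_self: "(x::bit fls) + x = 0"
  by (rule fls_eqI) simp

lemma fls_bit_uminus: "- (x::bit fls) = x"
  by (rule fls_eqI) simp

lemma fls_bit_two: "(2::bit fls) = 0"
  using fls_bit_add_self[of 1] by (simp only: one_add_one)

lemma fls_bit_sum_square: "(\<Sum>i\<in>A. z i)\<^sup>2 = (\<Sum>i\<in>A. (z i)\<^sup>2 :: bit fls)"
proof (induction A rule: infinite_finite_induct)
  case (insert a A)
  have "(z a + (\<Sum>i\<in>A. z i))\<^sup>2 = (z a)\<^sup>2 + (\<Sum>i\<in>A. z i)\<^sup>2"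
    by (simp only: power2_sum fls_bit_two mult_zero_left add_0_right)
  then show ?case
    using insert by simp
qed simp_all

lemma fls_bit_sum_power: "(\<Sum>i\<in>A. z i) ^ (2 ^ m) = (\<Sum>i\<in>A. z i ^ (2 ^ m) :: bit fls)"
proof (induction m)
  case (Suc m)
  have "x ^ (2 ^ Suc m) = (x ^ (2 ^ m))\<^sup>2" for x :: "bit fls"
    by (simp only: power_mult[symmetric] power_Suc2)
  then show ?case
    by (simp only: Suc fls_bit_sum_square)
qed simp

section \<open>Roots of power series equations\<close>

lemma fps_X_power_dvd_iff_nth:
  "fps_X ^ n dvd (f :: 'a::comm_ring_1 fps) \<longleftrightarrow> (\<forall>i<n. f $ i = 0)"
proof
  assume "\<forall>i<n. f $ i = 0"
  then have "f = fps_X ^ n * fps_shift n f"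
    by (intro fps_ext) (simp add: fps_X_power_mult_nth)
  then show "fps_X ^ n dvd f" by (rule dvdI)
qed (auto simp: fps_X_power_mult_nth elim!: dvdE)

text \<open>
  The iterates from a constant agree with one another in more and more coefficients; the fixed point
  is their coefficientwise limit.
\<close>

lemma fps_contraction_fixpoint:
  fixes T :: "'a::comm_ring_1 fps \<Rightarrow> 'a fps"
  assumes maps: "\<And>y. y $ 0 = c \<Longrightarrow> T y $ 0 = c"
    and contr: "\<And>n y z. y $ 0 = c \<Longrightarrow> z $ 0 = c \<Longrightarrow> fps_X ^ n dvd y - z \<Longrightarrow> fps_X ^ Suc n dvd T y - T z"
  obtains y where "y $ 0 = c" "T y = y"
proof -
  define Y where "Y n = (T ^^ n) (fps_const c)" for n
  have Y_Suc: "Y (Suc n) = T (Y n)" for n by (simp add: Y_def)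
  have Y0: "Y n $ 0 = c" for n
    by (induction n) (simp_all add: Y_def maps)
  have step: "fps_X ^ n dvd Y (Suc n) - Y n" for n
  proof (induction n)
    case (Suc n)
    show ?case
      using contr[OF Y0[of "Suc n"] Y0[of n] Suc] by (simp only: Y_Suc)
  qed simp
  have stable: "Y m $ i = Y (Suc i) $ i" if "Suc i \<le> m" for m i
    using that
  proof (induction m rule: dec_induct)
    case (step n)
    have "(Y (Suc n) - Y n) $ i = 0"
      using \<open>fps_X ^ n dvd Y (Suc n) - Y n\<close> step.hyps unfolding fps_X_power_dvd_iff_nth by simp
    then show ?case using step.IH by simp
  qed simp
  define y where "y = Abs_fps (\<lambda>i. Y (Suc i) $ i)"
  have y0: "y $ 0 = c" by (simp add: y_def Y0)
  have close: "fps_X ^ n dvd y - Y n" for n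
    unfolding fps_X_power_dvd_iff_nth
  proof (intro allI impI)
    fix i assume "i < n"
    then have "Y n $ i = Y (Suc i) $ i" by (intro stable) simp
    then show "(y - Y n) $ i = 0" by (simp add: y_def)
  qed
  have "T y $ i = y $ i" for i
  proof -
    have "fps_X ^ Suc i dvd T y - Y (Suc i)"
      unfolding Y_Suc by (rule contr) (simp_all add: y0 Y0 close)
    moreover have "fps_X ^ Suc i dvd y - Y (Suc i)" by (rule close)
    ultimately have "(T y - Y (Suc i)) $ i = 0" "(y - Y (Suc i)) $ i = 0"
      unfolding fps_X_power_dvd_iff_nth by blast+
    then show ?thesis by simp
  qed
  then have "T y = y" by (simp add: fps_ext)
  with y0 that show thesis by blast
qed

lemma dvd_diff_mult:
  fixes d :: "'a::comm_ring_1"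
  assumes "d dvd a - b" "d dvd p - q"
  shows "d dvd a * p - b * q"
proof -
  have "a * p - b * q = (a - b) * p + b * (p - q)" by (simp add: algebra_simps)
  then show ?thesis using assms by simp
qed

lemma dvd_diff_power:
  fixes d :: "'a::comm_ring_1"
  assumes "d dvd a - b"
  shows "d dvd a ^ n - b ^ n"
  by (induction n) (simp_all add: assms dvd_diff_mult)

text \<open>
  This is Hensel's lemma for a polynomial that is \<open>Y^(i + 1) - Y^i\<close> modulo \<open>X\<close>, at its simple root \<open>1\<close>.
  The equation is solved for \<open>Y\<close> by dividing by \<open>Y^i\<close>, which turns it into a contraction on the
  series with constant term \<open>1\<close>.
\<close>

lemma fps_two_term_root:
  fixes h :: "nat \<Rightarrow> nat"
  assumes "\<And>j. j \<in> J \<Longrightarrow> h j > 0"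
  obtains y :: "'a::field fps" where "y $ 0 = 1" "y ^ Suc i - y ^ i + (\<Sum>j\<in>J. fps_X ^ h j * y ^ j) = 0"
proof -
  define G where "G y = - (inverse y ^ i * (\<Sum>j\<in>J. fps_X ^ (h j - 1) * y ^ j))" for y :: "'a fps"
  obtain y :: "'a fps" where y: "y $ 0 = 1" "1 + fps_X * G y = y"
  proof (rule fps_contraction_fixpoint[of 1 "\<lambda>y. 1 + fps_X * G y"])
    fix n :: nat and y z :: "'a fps"
    assume 1: "y $ 0 = 1" "z $ 0 = 1" and d: "fps_X ^ n dvd y - z"
    have inv: "y * inverse y = 1" "z * inverse z = 1"
      using 1 by (simp_all add: inverse_mult_eq_1')
    have "inverse y - inverse z = (y * inverse y) * (- inverse z) + (z * inverse z) * inverse y"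
      using inv by simp
    also have "\<dots> = - ((y - z) * (inverse y * inverse z))"
      by (simp add: algebra_simps)
    finally have "fps_X ^ n dvd inverse y - inverse z" using d by simp
    then have "fps_X ^ n dvd inverse y ^ i - inverse z ^ i" by (rule dvd_diff_power)
    moreover have "fps_X ^ n dvd (\<Sum>j\<in>J. fps_X ^ (h j - 1) * y ^ j) - (\<Sum>j\<in>J. fps_X ^ (h j - 1) * z ^ j)"
      unfolding sum_subtractf[symmetric]
      by (intro dvd_sum) (use d in \<open>simp add: dvd_diff_power flip: right_diff_distrib\<close>)
    ultimately have "fps_X ^ n dvd G z - G y"
      unfolding G_def by (simp add: dvd_diff_mult)
    then have "fps_X ^ n dvd G y - G z" by (subst dvd_diff_commute)
    then have "fps_X * fps_X ^ n dvd fps_X * (G y - G z)" by (rule mult_dvd_mono[OF dvd_refl])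
    then show "fps_X ^ Suc n dvd (1 + fps_X * G y) - (1 + fps_X * G z)"
      by (simp add: algebra_simps)
  qed simp_all
  have inv: "y * inverse y = 1" using y(1) by (simp add: inverse_mult_eq_1')
  have "y - 1 = fps_X * G y"
    using y(2) by (metis add_diff_cancel_left')
  then have "y ^ Suc i - y ^ i = y ^ i * (fps_X * G y)"
    by (metis power_Suc2 right_diff_distrib mult.right_neutral)
  also have "\<dots> = - (y ^ i * inverse y ^ i * (fps_X * (\<Sum>j\<in>J. fps_X ^ (h j - 1) * y ^ j)))"
    by (simp add: G_def)
  also have "y ^ i * inverse y ^ i = 1"
    using inv by (metis power_mult_distrib power_one)
  also have "fps_X * (\<Sum>j\<in>J. fps_X ^ (h j - 1) * y ^ j) = (\<Sum>j\<in>J. fps_X ^ h j * y ^ j)"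
    unfolding sum_distrib_left
  proof (rule sum.cong[OF refl])
    fix j assume "j \<in> J"
    then have "fps_X ^ h j = (fps_X :: 'a fps) * fps_X ^ (h j - 1)"
      using assms by (metis power_eq_if not_gr0)
    then show "fps_X * (fps_X ^ (h j - 1) * y ^ j) = fps_X ^ h j * y ^ j" by simp
  qed
  finally show thesis using that[OF y(1)] by simp
qed

section \<open>Evaluation of bivariate polynomials\<close>

lemma poly_map_poly_add:
  assumes "h 0 = 0" "\<And>a b. h (a + b) = h a + h b"
  shows "poly (map_poly h (p + q)) x = poly (map_poly h p) x + poly (map_poly h q) x"
proof -
  have "map_poly h (p + q) = map_poly h p + map_poly h q"
    by (rule poly_eqI) (simp add: coeff_map_poly assms)
  then show ?thesis by simp
qed

lemma poly_map_poly_mult: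
  assumes "h 0 = 0" "\<And>a b. h (a + b) = h a + h b" "\<And>a b. h (a * b) = h a * h b"
  shows "poly (map_poly h (p * q)) x = poly (map_poly h p) x * poly (map_poly h q) (x :: 'a::comm_ring_1)"
proof (induction p)
  case (pCons a p)
  have "map_poly h (smult a q) = smult (h a) (map_poly h q)"
    by (rule poly_eqI) (simp add: coeff_map_poly assms)
  then show ?case
    using pCons by (simp add: poly_map_poly_add map_poly_pCons assms algebra_simps)
qed simp

text \<open>
  Here \<open>v\<close> is substituted for the outer variable \<open>V\<close> and \<open>u\<close> for the variable of the coefficients.
\<close>

definition eval2 :: "('a::comm_ring_1 \<Rightarrow> 'b::comm_ring_1) \<Rightarrow> 'b \<Rightarrow> 'b \<Rightarrow> 'a poly poly \<Rightarrow> 'b" where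
  "eval2 h u v P = poly (map_poly (\<lambda>c. poly (map_poly h c) u) P) v"

lemma eval2_add:
  assumes "h 0 = 0" "\<And>a b. h (a + b) = h a + h b"
  shows "eval2 h u v (P + Q) = eval2 h u v P + eval2 h u v Q"
  unfolding eval2_def by (intro poly_map_poly_add) (simp_all add: poly_map_poly_add assms)

lemma eval2_mult:
  assumes "h 0 = 0" "\<And>a b. h (a + b) = h a + h b" "\<And>a b. h (a * b) = h a * h b"
  shows "eval2 h u v (P * Q) = eval2 h u v P * eval2 h u v Q"
  unfolding eval2_def by (intro poly_map_poly_mult) (simp_all add: poly_map_poly_add poly_map_poly_mult assms)

lemma eval2_sum:
  assumes "h 0 = 0" "\<And>a b. h (a + b) = h a + h b"
  shows "eval2 h u v (\<Sum>i\<in>A. P i) = (\<Sum>i\<in>A. eval2 h u v (P i))"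
  by (induction A rule: infinite_finite_induct)
     (simp_all add: eval2_add[of h, OF assms], simp_all add: eval2_def)

lemma eval2_monom:
  assumes "h 0 = 0"
  shows "eval2 h u v (monom (monom c a) b) = h c * u ^ a * v ^ b"
  by (simp add: eval2_def assms map_poly_monom poly_monom)

lemma poly_poly_monom_expansion:
  "P = (\<Sum>b\<le>degree P. \<Sum>a\<le>degree (coeff P b). monom (monom (coeff (coeff P b) a) a) b)"
proof -
  have "(\<Sum>a\<le>degree c. monom (monom (coeff c a) a) b) = monom c b" for c :: "'a poly" and b
  proof -
    have "(\<Sum>a\<le>degree c. monom (monom (coeff c a) a) b) = monom (\<Sum>a\<le>degree c. monom (coeff c a) a) b"
      by (rule poly_eqI) (simp add: coeff_sum)
    then show ?thesis by (simp add: poly_as_sum_of_monoms)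
  qed
  then show ?thesis by (simp add: poly_as_sum_of_monoms)
qed

section \<open>An irreducible polynomial\<close>

text \<open>
  The product \<open>j * (k - j)\<close> makes the sequence strictly concave. The summand for \<open>j < k\<close> makes the ends
  \<open>1\<close> and \<open>0\<close>, so that the lower edge of the Newton polygon, from \<open>(1, 0)\<close> to \<open>(0, k)\<close>, contains no further
  lattice point; this is what makes the polynomial irreducible.
\<close>

definition expo :: "nat \<Rightarrow> nat \<Rightarrow> nat" where
  "expo k j = j * (k - j) + (if j < k then 1 else 0)"

definition mixing_poly :: "nat \<Rightarrow> bit poly poly" where
  "mixing_poly k = (\<Sum>j\<le>k. monom (monom 1 (expo k j)) j)"

text \<open>
  The substitution \<open>u = X^k\<close>, \<open>V = X * t\<close> gives \<open>u\<close> weight \<open>k\<close> and \<open>V\<close> weight \<open>1\<close>. The coefficient of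
  \<open>X^m\<close> is then the part of weight \<open>m\<close>, as a polynomial in \<open>t\<close>, and the lowest one is multiplicative.
\<close>

definition weighted :: "nat \<Rightarrow> bit poly poly \<Rightarrow> bit poly fps" where
  "weighted k = eval2 (\<lambda>c. fps_const [:c:]) (fps_X ^ k) (fps_X * fps_const [:0, 1:])"

lemma weighted_mult: "weighted k (P * Q) = weighted k P * weighted k Q"
  unfolding weighted_def by (rule eval2_mult) (simp_all flip: fps_const_add)

lemma weighted_sum: "weighted k (\<Sum>i\<in>A. P i) = (\<Sum>i\<in>A. weighted k (P i))"
  unfolding weighted_def by (rule eval2_sum) (simp_all flip: fps_const_add)

lemma weighted_monom_nth:
  "weighted k (monom (monom c a) b) $ m = (if m = k * a + b then monom c b else 0)"
proof -
  have "[:c:] * [:0, 1:] ^ b = monom c b"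
    by (simp add: monom_altdef)
  moreover have "(fps_X ^ k) ^ a * (fps_X * fps_const [:0, 1:]) ^ b
      = fps_const ([:0, 1:] ^ b) * (fps_X ^ (k * a + b) :: bit poly fps)"
    by (simp add: power_mult_distrib power_add mult_ac flip: power_mult)
  ultimately have "weighted k (monom (monom c a) b) = fps_const (monom c b) * fps_X ^ (k * a + b)"
    unfolding weighted_def by (simp add: eval2_monom mult.assoc fps_const_mult[symmetric] del: fps_const_mult)
  then show ?thesis by simp
qed

text \<open>
  For \<open>V\<close>-degree below \<open>k\<close> a weight \<open>k * a + b\<close> determines \<open>a\<close> and \<open>b\<close>, so every weighted part is a
  single monomial.
\<close>

lemma weighted_nth:
  assumes "degree P < k"
  shows "weighted k P $ m = monom (coeff (coeff P (m mod k)) (m div k)) (m mod k)"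
proof -
  have "weighted k P $ m = (\<Sum>b\<le>degree P. \<Sum>a\<le>degree (coeff P b).
      if m = k * a + b then monom (coeff (coeff P b) a) b else 0)"
    by (subst poly_poly_monom_expansion) (simp add: weighted_sum fps_sum_nth weighted_monom_nth)
  also have "\<dots> = (\<Sum>b\<le>degree P. if b = m mod k then monom (coeff (coeff P b) (m div k)) b else 0)"
  proof (rule sum.cong[OF refl])
    fix b assume "b \<in> {..degree P}"
    then have "b < k" using assms by simp
    then have eq: "m = k * a + b \<longleftrightarrow> b = m mod k \<and> a = m div k" for a
      by auto
    have "(\<Sum>a\<le>degree (coeff P b). if m = k * a + b then monom (coeff (coeff P b) a) b else 0)
        = (\<Sum>a\<le>degree (coeff P b). if a = m div k then (if b = m mod k then monom (coeff (coeff P b) a) b else 0) else 0)"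
      unfolding eq by (rule sum.cong) auto
    also have "\<dots> = (if b = m mod k then monom (coeff (coeff P b) (m div k)) b else 0)"
      by (auto simp: coeff_eq_0)
    finally show "(\<Sum>a\<le>degree (coeff P b). if m = k * a + b then monom (coeff (coeff P b) a) b else 0)
      = (if b = m mod k then monom (coeff (coeff P b) (m div k)) b else 0)" .
  qed
  also have "\<dots> = monom (coeff (coeff P (m mod k)) (m div k)) (m mod k)"
    by (auto simp: coeff_eq_0)
  finally show ?thesis .
qed

lemma weighted_low:
  assumes "degree P < k" "P \<noteq> 0"
  obtains c b where "c \<noteq> 0" "weighted k P \<noteq> 0"
    "weighted k P $ subdegree (weighted k P) = monom c b"
proof -
  have "coeff P (degree P) \<noteq> 0" using assms by simp
  then obtain a where a: "coeff (coeff P (degree P)) a \<noteq> 0"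
    by (metis leading_coeff_0_iff)
  have "weighted k P $ (k * a + degree P) \<noteq> 0"
    using assms a by (simp add: weighted_nth)
  then have nz: "weighted k P \<noteq> 0" by auto
  then have "weighted k P $ subdegree (weighted k P) \<noteq> 0" by simp
  moreover obtain c b where "weighted k P $ subdegree (weighted k P) = monom c b"
    using weighted_nth[OF assms(1)] by blast
  ultimately show thesis using nz that by (metis monom_0 monom_eq_0_iff)
qed

lemma weighted_mixing_poly:
  assumes "k \<ge> 1"
  shows "subdegree (weighted k (mixing_poly k)) = k"
    "weighted k (mixing_poly k) $ k = 1 + monom 1 k"
proof -
  have nth: "weighted k (mixing_poly k) $ m = (\<Sum>j\<le>k. if m = k * expo k j + j then monom 1 j else 0)" for m
    by (simp add: mixing_poly_def weighted_sum weighted_monom_nth fps_sum_nth)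
  have big: "k * expo k j + j > k" if "0 < j" "j < k" for j
  proof -
    have "k * 1 \<le> k * expo k j" using that by (intro mult_left_mono) (auto simp: expo_def)
    then show ?thesis using that by linarith
  qed
  have ends: "k * expo k 0 + 0 = k" "k * expo k k + k = k"
    using assms by (simp_all add: expo_def)
  have ge: "k * expo k j + j \<ge> k" if "j \<le> k" for j
    using big[of j] ends that by (cases "j = 0"; cases "j = k") auto
  have "weighted k (mixing_poly k) $ k = (\<Sum>j\<in>{0,k}. monom 1 j)"
    unfolding nth
  proof (rule sum.mono_neutral_cong_right)
    show "\<forall>j\<in>{..k} - {0, k}. (if k = k * expo k j + j then monom 1 j else 0) = (0 :: bit poly)"
    proof
      fix j assume "j \<in> {..k} - {0, k}"
      then have "k \<noteq> k * expo k j + j" using big[of j] by force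
      then show "(if k = k * expo k j + j then monom 1 j else 0) = (0 :: bit poly)" by simp
    qed
    fix j assume "j \<in> {0, k}"
    then have "k = k * expo k j + j" using ends by fastforce
    then show "(if k = k * expo k j + j then monom 1 j else 0) = (monom 1 j :: bit poly)" by simp
  qed auto
  also have "\<dots> = 1 + monom 1 k" using assms by (simp add: one_pCons monom_0)
  finally show val: "weighted k (mixing_poly k) $ k = 1 + monom 1 k" .
  have "coeff (1 + monom 1 k :: bit poly) k \<noteq> 0" using assms by simp
  then have "1 + monom 1 k \<noteq> (0 :: bit poly)" by (metis coeff_0)
  moreover have "weighted k (mixing_poly k) $ m = 0" if "m < k" for m
    unfolding nth
  proof (rule sum.neutral, rule ballI)
    fix j assume "j \<in> {..k}"
    then have "m \<noteq> k * expo k j + j" using ge[of j] that by force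
    then show "(if m = k * expo k j + j then monom 1 j else 0) = (0 :: bit poly)" by simp
  qed
  ultimately show "subdegree (weighted k (mixing_poly k)) = k"
    by (intro subdegreeI) (auto simp: val)
qed

text \<open>
  Irreducibility over the rational functions in \<open>u\<close>, in denominator-free form. By \<open>weighted_low\<close> the
  lowest weighted parts of \<open>a\<close>, \<open>g\<close> and \<open>q\<close> are monomials, but that of the polynomial itself is
  \<open>1 + t^k\<close>, and a monomial times \<open>1 + t^k\<close> is not a monomial.
\<close>

lemma mixing_poly_no_factor:
  assumes "k \<ge> 1" "a \<noteq> 0" "smult a (mixing_poly k) = g * q" "degree g < k" "degree q < k"
  shows False
proof -
  have "1 + monom 1 k \<noteq> (0 :: bit poly)"
    using assms(1) by (metis (no_types) add_cancel_right_left coeff_0 coeff_add coeff_monom degree_1 leD coeff_eq_0 less_le_trans zero_less_one zero_neq_one)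
  then have nzf: "weighted k (mixing_poly k) \<noteq> 0"
    using weighted_mixing_poly[OF assms(1)] by auto
  then have "mixing_poly k \<noteq> 0" by (auto simp: weighted_def eval2_def)
  then have "g * q \<noteq> 0" using assms by (metis smult_eq_0_iff)
  then have nz: "g \<noteq> 0" "q \<noteq> 0" by auto
  have "degree [:a:] < k" "[:a:] \<noteq> 0" using assms by simp_all
  then obtain ca ba where A: "ca \<noteq> 0" "weighted k [:a:] \<noteq> 0"
      "weighted k [:a:] $ subdegree (weighted k [:a:]) = monom ca ba"
    by (rule weighted_low)
  obtain cg bg where G: "cg \<noteq> 0" "weighted k g \<noteq> 0"
      "weighted k g $ subdegree (weighted k g) = monom cg bg"
    using weighted_low[OF assms(4) nz(1)] by blast
  obtain cq bq where Q: "cq \<noteq> 0" "weighted k q \<noteq> 0"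
      "weighted k q $ subdegree (weighted k q) = monom cq bq"
    using weighted_low[OF assms(5) nz(2)] by blast
  have low: "(x * y) $ subdegree (x * y) = x $ subdegree x * y $ subdegree y"
    if "x \<noteq> 0" "y \<noteq> 0" for x y :: "bit poly fps"
    using that by (simp add: subdegree_mult nth_subdegree_mult)
  have "weighted k [:a:] * weighted k (mixing_poly k) = weighted k g * weighted k q"
    using assms(3) by (simp flip: weighted_mult)
  then have "monom ca ba * (1 + monom 1 k) = monom (cg * cq) (bg + bq)"
    using low[OF A(2) nzf] low[OF G(2) Q(2)] A G Q weighted_mixing_poly[OF assms(1)]
    by (simp add: mult_monom)
  then have eq: "monom ca ba + monom ca (ba + k) = monom (cg * cq) (bg + bq)"
    by (simp only: distrib_left mult_1_right mult_monom)
  have "coeff (monom ca ba + monom ca (ba + k)) ba \<noteq> 0"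
      "coeff (monom ca ba + monom ca (ba + k)) (ba + k) \<noteq> 0"
    using assms(1) A(1) by simp_all
  then show False
    unfolding eq using assms(1) by (simp split: if_splits)
qed

lemma mixing_poly_degree: "degree (mixing_poly k) = k" and mixing_poly_nonzero: "mixing_poly k \<noteq> 0"
proof -
  have c: "coeff (mixing_poly k) i = (if i \<le> k then monom 1 (expo k i) else 0)" for i
    by (simp add: mixing_poly_def coeff_sum)
  show "degree (mixing_poly k) = k"
    by (rule antisym) (auto intro!: degree_le le_degree simp: c)
  show "mixing_poly k \<noteq> 0"
    using c[of k] by auto
qed

text \<open>
  Laurent series are expanded at infinity: the variable \<open>u\<close> becomes \<open>1/X\<close>.
\<close>

definition laurent_eval :: "bit fls \<Rightarrow> bit poly poly \<Rightarrow> bit fls" where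
  "laurent_eval = eval2 fls_const fls_X_inv"

lemma laurent_eval_mult: "laurent_eval v (P * Q) = laurent_eval v P * laurent_eval v Q"
  unfolding laurent_eval_def by (rule eval2_mult) (simp_all add: fls_plus_const)

lemma laurent_eval_add: "laurent_eval v (P + Q) = laurent_eval v P + laurent_eval v Q"
  unfolding laurent_eval_def by (rule eval2_add) (simp_all add: fls_plus_const)

lemma laurent_eval_sum: "laurent_eval v (\<Sum>i\<in>A. P i) = (\<Sum>i\<in>A. laurent_eval v (P i))"
  unfolding laurent_eval_def by (rule eval2_sum) (simp_all add: fls_plus_const)

lemma laurent_eval_monom: "laurent_eval v (monom (monom 1 a) b) = fls_X_inv ^ a * v ^ b"
  unfolding laurent_eval_def by (simp add: eval2_monom)

lemma laurent_eval_const_nonzero: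
  assumes "c \<noteq> 0"
  shows "laurent_eval v [:c:] \<noteq> 0"
proof -
  have "laurent_eval v [:c:] = poly (map_poly fls_const c) fls_X_inv"
    by (simp add: laurent_eval_def eval2_def map_poly_pCons)
  also have "\<dots> = (\<Sum>i\<le>degree c. fls_const (coeff c i) * fls_X_inv ^ i)"
    by (simp add: poly_altdef coeff_map_poly degree_map_poly)
  finally have expand: "laurent_eval v [:c:] = (\<Sum>i\<le>degree c. fls_const (coeff c i) * fls_X_inv ^ i)" .
  have nth: "fls_nth (fls_const a * fls_X_inv ^ i) (- int m) = (if i = m then a else 0)" for a :: bit and i m
    by (cases a) simp_all
  have "fls_nth (laurent_eval v [:c:]) (- int (degree c)) = lead_coeff c"
    unfolding expand fls_nth_sum nth by (simp only: sum.delta finite_atMost atMost_iff order_refl if_True)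
  also have "\<dots> \<noteq> 0" using assms by simp
  finally show ?thesis by auto
qed

text \<open>
  A polynomial of least degree that vanishes at \<open>v\<close> divides, up to a factor in \<open>u\<close>, the polynomial
  \<open>mixing_poly k\<close>; a degree below \<open>k\<close> would split the latter.
\<close>

lemma laurent_eval_low_degree_nonzero:
  assumes "k \<ge> 1" and root: "laurent_eval v (mixing_poly k) = 0"
    and "g \<noteq> 0" "degree g < k"
  shows "laurent_eval v g \<noteq> 0"
proof
  define bad where "bad g \<longleftrightarrow> g \<noteq> 0 \<and> degree g < k \<and> laurent_eval v g = 0" for g
  assume "laurent_eval v g = 0"
  then have "bad g" using assms by (simp add: bad_def)
  then obtain g where g: "bad g" and least: "\<And>h. bad h \<Longrightarrow> degree g \<le> degree h"
    using ex_has_least_nat[of bad g degree] by blast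
  have pos: "degree g > 0"
  proof (rule ccontr)
    assume "\<not> degree g > 0"
    then obtain c where "g = [:c:]" by (metis degree_eq_zeroE neq0_conv)
    then show False using laurent_eval_const_nonzero[of c v] g by (auto simp: bad_def)
  qed
  obtain a q where aq: "a \<noteq> 0" "smult a (mixing_poly k) = g * q + pseudo_mod (mixing_poly k) g"
    and r: "pseudo_mod (mixing_poly k) g = 0 \<or> degree (pseudo_mod (mixing_poly k) g) < degree g"
    using pseudo_mod[of g "mixing_poly k"] g unfolding bad_def by blast
  let ?r = "pseudo_mod (mixing_poly k) g"
  have "laurent_eval v ([:a:] * mixing_poly k) = 0"
    by (simp only: laurent_eval_mult root mult_zero_right)
  then have "laurent_eval v (smult a (mixing_poly k)) = 0" by simp
  then have "laurent_eval v ?r = 0"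
    using g unfolding aq(2) laurent_eval_add laurent_eval_mult bad_def by simp
  then have "?r = 0"
    using r least[of ?r] g unfolding bad_def by fastforce
  then have eq: "smult a (mixing_poly k) = g * q" using aq by simp
  then have "g * q \<noteq> 0" using aq(1) mixing_poly_nonzero by (metis smult_eq_0_iff)
  then have "degree g + degree q = k"
    using arg_cong[OF eq, of degree] aq(1) by (simp add: mixing_poly_degree degree_mult_eq)
  then show False
    using mixing_poly_no_factor[OF assms(1) aq(1) eq] pos g by (simp add: bad_def)
qed

text \<open>
  All roots of \<open>mixing_poly k\<close> satisfy the same polynomial relations over \<open>u\<close>. This is what lets one
  element of the ring be measured by several valuations.
\<close>

lemma laurent_eval_conjugate:
  assumes "k \<ge> 1" "laurent_eval v (mixing_poly k) = 0" "laurent_eval w (mixing_poly k) = 0"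
    and "laurent_eval v P = 0"
  shows "laurent_eval w P = 0"
proof -
  let ?f = "mixing_poly k" and ?r = "pseudo_mod P (mixing_poly k)"
  obtain a q where aq: "a \<noteq> 0" "smult a P = ?f * q + ?r"
    using pseudo_mod(1)[OF mixing_poly_nonzero, of P k] by blast
  have r: "?r = 0 \<or> degree ?r < degree ?f"
    by (rule pseudo_mod(2)[OF mixing_poly_nonzero])
  have "[:a:] * P = ?f * q + ?r" using aq(2) by simp
  then have ev: "laurent_eval x [:a:] * laurent_eval x P = laurent_eval x ?f * laurent_eval x q + laurent_eval x ?r" for x
    by (simp only: flip: laurent_eval_add laurent_eval_mult)
  have "laurent_eval v ?r = 0" using ev[of v] assms by simp
  then have "?r = 0"
    using laurent_eval_low_degree_nonzero[OF assms(1,2)] r by (auto simp: mixing_poly_degree)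
  then have "laurent_eval w [:a:] * laurent_eval w P = 0"
    using ev[of w] assms by (simp add: laurent_eval_def eval2_def)
  then show ?thesis using laurent_eval_const_nonzero[OF aq(1)] by simp
qed

section \<open>Its roots at infinity\<close>

text \<open>
  A root belonging to the edge between the terms \<open>i\<close> and \<open>i + 1\<close> grows like \<open>u\<close> to this power.
\<close>

definition slope :: "nat \<Rightarrow> nat \<Rightarrow> int" where
  "slope k i = int (expo k i) - int (expo k (Suc i))"

lemma int_expo: "l \<le> k \<Longrightarrow> int (expo k l) = int l * (int k - int l) + (if l < k then 1 else 0)"
  by (simp add: expo_def of_nat_diff)

lemma slope_eq:
  assumes "i < k"
  shows "slope k i = (if Suc i = k then int k else 2 * int i + 1 - int k)"
proof (cases "Suc i = k")
  case True
  then show ?thesis by (auto simp: slope_def expo_def)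
next
  case False
  then show ?thesis
    using assms by (simp add: slope_def int_expo algebra_simps)
qed

lemma slope_inj: "inj_on (slope k) {..<k}"
  by (rule inj_onI) (auto simp: slope_eq split: if_splits)

text \<open>
  Strict concavity: at a root of the given slope the terms \<open>i\<close> and \<open>i + 1\<close> dominate all others.
\<close>

lemma expo_below_edge:
  assumes "i < k" "j \<le> k" "j \<noteq> i" "j \<noteq> Suc i"
  shows "int (expo k j) + int j * slope k i < int (expo k i) + int i * slope k i"
proof -
  \<comment> \<open>except on the last edge the excess of the dominant terms is at least \<open>x * (x + 1)\<close>, which is positive since \<open>x\<close> is neither \<open>0\<close> nor \<open>- 1\<close>\<close>
  define x where "x = int i - int j"
  have x: "x \<noteq> 0" "x \<noteq> -1" using assms by (auto simp: x_def)
  show ?thesis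
  proof (cases "Suc i = k")
    case True
    then have K: "int k = int i + 1" by simp
    have "x \<ge> 1" using assms True x by (auto simp: x_def)
    then have "x * x + 2 * x > 0" by (intro add_pos_pos) auto
    moreover have "int (expo k i) + int i * slope k i - (int (expo k j) + int j * slope k i)
        = x * x + 2 * x + (if j < k then 0 else 1)"
      using assms True unfolding slope_eq[OF assms(1)] int_expo[OF assms(2)] int_expo[OF less_imp_le[OF assms(1)]]
      by (simp add: K x_def algebra_simps)
    moreover have "x * x + 2 * x + (if j < k then 0 else 1) \<ge> x * x + 2 * x" by simp
    ultimately show ?thesis by linarith
  next
    case False
    have "x * (x + 1) \<ge> 1"
    proof (cases "x > 0")
      case True
      then have "x * (x + 1) > 0" by simp
      then show ?thesis by simp
    next
      case False
      then have "x < 0" "x + 1 < 0" using x by auto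
      then have "x * (x + 1) > 0" by (rule mult_neg_neg)
      then show ?thesis by simp
    qed
    moreover have "int (expo k i) + int i * slope k i - (int (expo k j) + int j * slope k i)
        = x * (x + 1) + (if j < k then 0 else 1)"
      using assms False unfolding slope_eq[OF assms(1)] int_expo[OF assms(2)] int_expo[OF less_imp_le[OF assms(1)]]
      by (simp add: x_def algebra_simps)
    moreover have "x * (x + 1) + (if j < k then 0 else 1) \<ge> x * (x + 1)" by simp
    ultimately show ?thesis by linarith
  qed
qed

lemma sum_fps_to_fls: "fps_to_fls (\<Sum>i\<in>A. f i) = (\<Sum>i\<in>A. fps_to_fls (f i))"
  by (induction A rule: infinite_finite_induct) simp_all

text \<open>
  After the substitution \<open>V = u^d * y\<close>, with \<open>d\<close> the slope of the edge, and division by the dominant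
  power of \<open>u\<close>, the equation has the form treated in \<open>fps_two_term_root\<close>.
\<close>

lemma mixing_poly_root:
  assumes "i < k"
  obtains v where "laurent_eval v (mixing_poly k) = 0" "v \<noteq> 0" "fls_subdegree v = - slope k i"
proof -
  let ?d = "slope k i"
  define c where "c = int (expo k i) + int i * ?d"
  \<comment> \<open>\<open>h j\<close> is how far the term \<open>j\<close> lies below the edge\<close>
  define h where "h j = nat (c - int (expo k j) - int j * ?d)" for j
  define J where "J = {..k} - {i, Suc i}"
  have "h j > 0" if "j \<in> J" for j
    using expo_below_edge[of i k j] assms that by (auto simp: J_def h_def c_def)
  then obtain y :: "bit fps" where y: "y $ 0 = 1" "y ^ Suc i - y ^ i + (\<Sum>j\<in>J. fps_X ^ h j * y ^ j) = 0"
    by (rule fps_two_term_root)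
  have hi: "h i = 0" "h (Suc i) = 0"
    by (simp_all add: h_def c_def slope_def algebra_simps)
  have hge: "int (h j) = c - int (expo k j) - int j * ?d" if "j \<le> k" for j
    using expo_below_edge[of i k j] assms that hi
    by (cases "j = i \<or> j = Suc i") (auto simp: h_def c_def slope_def algebra_simps)
  define v where "v = fls_X_intpow (- ?d) * fps_to_fls y"
  have ynz: "y \<noteq> 0" using y(1) by auto
  have vpow: "fls_X_inv ^ expo k j * v ^ j = fls_X_intpow (- c) * fps_to_fls (fps_X ^ h j * y ^ j)" if "j \<le> k" for j
  proof -
    have pow: "(fls_X_intpow (- ?d) :: bit fls) ^ j = fls_X_intpow (int j * - ?d)"
      by (rule fls_X_intpow_power)
    have "fls_X_inv ^ expo k j * v ^ j
        = fls_X_intpow (- int (expo k j)) * (fls_X_intpow (int j * - ?d) * fps_to_fls (y ^ j))"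
      by (simp only: v_def power_mult_distrib pow fps_to_fls_power)
         (simp only: fls_X_inv_power_conv_shift_1 minus_minus)
    also have "\<dots> = fls_X_intpow (- int (expo k j) + int j * - ?d) * fps_to_fls (y ^ j)"
      by (simp only: fls_X_intpow_times_fls_X_intpow flip: mult.assoc)
    also have "- int (expo k j) + int j * - ?d = - c + int (h j)"
      using hge[OF that] by simp
    also have "fls_X_intpow (- c + int (h j)) * fps_to_fls (y ^ j)
        = fls_X_intpow (- c) * (fls_X_intpow (int (h j)) * fps_to_fls (y ^ j))"
      by (simp only: fls_X_intpow_times_fls_X_intpow flip: mult.assoc)
    also have "fls_X_intpow (int (h j)) * fps_to_fls (y ^ j) = fps_to_fls (fps_X ^ h j * y ^ j)"
      by (simp add: fls_times_fps_to_fls fps_to_fls_power fls_X_power_conv_shift_1)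
    finally show ?thesis .
  qed
  have "{..k} = insert i (insert (Suc i) J)" "finite J" "i \<notin> insert (Suc i) J" "Suc i \<notin> J"
    using assms by (auto simp: J_def)
  then have "(\<Sum>j\<le>k. fps_X ^ h j * y ^ j) = y ^ i + (y ^ Suc i + (\<Sum>j\<in>J. fps_X ^ h j * y ^ j))"
    by (simp add: hi)
  also have "\<dots> = y ^ Suc i - y ^ i + (\<Sum>j\<in>J. fps_X ^ h j * y ^ j) + 2 * y ^ i"
    by (simp add: algebra_simps)
  \<comment> \<open>signs do not matter in characteristic two, so that the sum of the two edge terms may be read as a difference\<close>
  also have "2 = (0 :: bit fps)"
    by (rule fps_ext) (simp add: numeral_fps_const)
  finally have sum0: "(\<Sum>j\<le>k. fps_X ^ h j * y ^ j) = 0"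
    using y(2) by simp
  have "laurent_eval v (mixing_poly k) = (\<Sum>j\<le>k. fls_X_intpow (- c) * fps_to_fls (fps_X ^ h j * y ^ j))"
    by (simp add: mixing_poly_def laurent_eval_sum laurent_eval_monom vpow)
  also have "\<dots> = fls_X_intpow (- c) * fps_to_fls (\<Sum>j\<le>k. fps_X ^ h j * y ^ j)"
    by (simp only: sum_fps_to_fls flip: sum_distrib_left)
  finally have "laurent_eval v (mixing_poly k) = 0" by (simp add: sum0)
  have "subdegree y = 0" using y(1) by simp
  moreover have X: "(fls_X_intpow (- ?d) :: bit fls) \<noteq> 0" by (rule fls_X_intpow_nonzero)
  moreover have "fps_to_fls y \<noteq> 0" using ynz by simp
  ultimately have "fls_subdegree v = - ?d" "v \<noteq> 0"
    unfolding v_def by (simp_all only: fls_subdegree_mult fls_subdegree_fls_X_intpow fls_subdegree_fls_to_fps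
        mult_eq_0_iff of_nat_0 add_0_right simp_thms)
  with \<open>laurent_eval v (mixing_poly k) = 0\<close> show thesis using that by blast
qed

section \<open>Independence of few monomials that are far apart\<close>

definition monomial :: "bit fls \<Rightarrow> int \<times> int \<Rightarrow> bit fls" where
  "monomial v n = fls_X_inv powi fst n * v powi snd n"

lemma monomial_add: "v \<noteq> 0 \<Longrightarrow> monomial v (m + n) = monomial v m * monomial v n"
  by (simp add: monomial_def power_int_add mult_ac)

lemma monomial_zero: "monomial v 0 = 1"
  by (simp add: monomial_def)

lemma monomial_nonzero: "v \<noteq> 0 \<Longrightarrow> monomial v n \<noteq> 0"
  by (simp add: monomial_def)

lemma monomial_subdegree: "v \<noteq> 0 \<Longrightarrow> fls_subdegree (monomial v n) = - fst n + snd n * fls_subdegree v"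
  by (simp add: monomial_def)

text \<open>
  Multiplication by a common monomial clears the negative exponents and reduces the claim to
  polynomials.
\<close>

lemma sum_monomial_conjugate:
  assumes "k \<ge> 1" "laurent_eval v (mixing_poly k) = 0" "laurent_eval w (mixing_poly k) = 0"
    "v \<noteq> 0" "w \<noteq> 0" "finite A" and "(\<Sum>a\<in>A. monomial v (f a)) = 0"
  shows "(\<Sum>a\<in>A. monomial w (f a)) = 0"
proof -
  define N where "N = (\<Sum>a\<in>A. \<bar>fst (f a)\<bar> + \<bar>snd (f a)\<bar>)"
  have N: "fst (f a) + N \<ge> 0" "snd (f a) + N \<ge> 0" if "a \<in> A" for a
  proof -
    have "\<bar>fst (f a)\<bar> + \<bar>snd (f a)\<bar> \<le> N"
      unfolding N_def by (rule member_le_sum[OF that]) (use assms in auto)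
    then show "fst (f a) + N \<ge> 0" "snd (f a) + N \<ge> 0" by linarith+
  qed
  define P where "P = (\<Sum>a\<in>A. monom (monom 1 (nat (fst (f a) + N))) (nat (snd (f a) + N)) :: bit poly poly)"
  have ev: "laurent_eval x P = monomial x (N, N) * (\<Sum>a\<in>A. monomial x (f a))" if "x \<noteq> 0" for x
    unfolding P_def laurent_eval_sum laurent_eval_monom sum_distrib_left
  proof (rule sum.cong[OF refl])
    fix a assume "a \<in> A"
    then have "fls_X_inv ^ nat (fst (f a) + N) = (fls_X_inv :: bit fls) powi (fst (f a) + N)"
        "x ^ nat (snd (f a) + N) = x powi (snd (f a) + N)"
      using N by (simp_all add: power_int_def)
    then show "fls_X_inv ^ nat (fst (f a) + N) * x ^ nat (snd (f a) + N) = monomial x (N, N) * monomial x (f a)"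
      using that by (simp add: monomial_def power_int_add)
  qed
  have "laurent_eval v P = 0" using ev assms by simp
  then have "laurent_eval w P = 0" using laurent_eval_conjugate assms by blast
  then show ?thesis using ev[of w] monomial_nonzero[of w] assms by simp
qed

lemma fls_sum_zero_two_minimal:
  fixes z :: "'s \<Rightarrow> 'a::comm_ring_1 fls"
  assumes "finite I" "I \<noteq> {}" "\<And>s. s \<in> I \<Longrightarrow> z s \<noteq> 0" "(\<Sum>s\<in>I. z s) = 0"
  obtains a b where "a \<in> I" "b \<in> I" "a \<noteq> b"
    "\<And>s. s \<in> I \<Longrightarrow> fls_subdegree (z a) \<le> fls_subdegree (z s)"
    "\<And>s. s \<in> I \<Longrightarrow> fls_subdegree (z b) \<le> fls_subdegree (z s)"
proof -
  define m where "m = Min (fls_subdegree ` z ` I)"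
  have "m \<in> fls_subdegree ` z ` I" unfolding m_def using assms by (intro Min_in) auto
  then obtain a where a: "a \<in> I" "fls_subdegree (z a) = m" by auto
  have least: "m \<le> fls_subdegree (z s)" if "s \<in> I" for s
    unfolding m_def using assms that by (intro Min_le) auto
  have "(\<Sum>s\<in>I. fls_nth (z s) m) = 0"
    using arg_cong[OF assms(4), of "\<lambda>f. fls_nth f m"] by (simp add: fls_nth_sum)
  also have "(\<Sum>s\<in>I. fls_nth (z s) m) = fls_nth (z a) m + (\<Sum>s\<in>I - {a}. fls_nth (z s) m)"
    using assms(1) a(1) by (rule sum.remove)
  finally have eq: "fls_nth (z a) m + (\<Sum>s\<in>I - {a}. fls_nth (z s) m) = 0" by simp
  have "fls_nth (z a) m \<noteq> 0" using a assms(3)[of a] by auto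
  then have "(\<Sum>s\<in>I - {a}. fls_nth (z s) m) \<noteq> 0" using eq by auto
  then obtain b where b: "b \<in> I - {a}" "fls_nth (z b) m \<noteq> 0" by (meson sum.neutral)
  then have "fls_subdegree (z b) \<le> m" by (simp add: fls_subdegree_leI)
  then show thesis using that[of a b] a b least by force
qed

text \<open>
  The points are \<open>(p s, q s)\<close>, and \<open>p + d i * q\<close> is the functional constant along the \<open>i\<close>-th edge
  direction \<open>(- d i, 1)\<close>. Two points far from one another on which it is nearly maximal differ mostly in this
  direction. Label the upper one \<open>b i\<close>. If \<open>b i = b j\<close> with \<open>d i < d j\<close>, then going down along the
  edge \<open>j\<close> increases the functional of the edge \<open>i\<close> beyond its maximum; hence the \<open>b i\<close> are distinct, and the lowest
  point is one more.
\<close>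

lemma edges_need_points:
  fixes p q :: "'s \<Rightarrow> int" and d :: "nat \<Rightarrow> int"
  assumes I: "finite I" "I \<noteq> {}" and d: "inj_on d {..<k}" and "C \<ge> 0"
    and edges: "\<And>i. i < k \<Longrightarrow> \<exists>a\<in>I. \<exists>b\<in>I. a \<noteq> b \<and>
      (\<forall>s\<in>I. p s + d i * q s \<le> p a + d i * q a + C) \<and> (\<forall>s\<in>I. p s + d i * q s \<le> p b + d i * q b + C)"
    and far: "\<And>a b. a \<in> I \<Longrightarrow> b \<in> I \<Longrightarrow> a \<noteq> b \<Longrightarrow> \<bar>p a - p b\<bar> > N \<or> \<bar>q a - q b\<bar> > N"
    and N: "\<And>i. i < k \<Longrightarrow> C + \<bar>d i\<bar> * (2 * C) \<le> N" "2 * C \<le> N"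
  shows "k < card I"
proof -
  have "\<exists>a b. a \<in> I \<and> b \<in> I \<and> a \<noteq> b \<and> q a \<le> q b \<and> (\<forall>s\<in>I. p s + d i * q s \<le> p a + d i * q a + C)
      \<and> (\<forall>s\<in>I. p s + d i * q s \<le> p b + d i * q b + C)" if "i < k" for i
    using edges[OF that] by (metis linorder_linear)
  then obtain a b where ab: "\<And>i. i < k \<Longrightarrow> a i \<in> I \<and> b i \<in> I \<and> a i \<noteq> b i \<and> q (a i) \<le> q (b i)
      \<and> (\<forall>s\<in>I. p s + d i * q s \<le> p (a i) + d i * q (a i) + C)
      \<and> (\<forall>s\<in>I. p s + d i * q s \<le> p (b i) + d i * q (b i) + C)"
    by metis
  have tall: "2 * C < q (b i) - q (a i)" if "i < k" for i
  proof (rule ccontr)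
    assume "\<not> 2 * C < q (b i) - q (a i)"
    then have le: "\<bar>q (b i) - q (a i)\<bar> \<le> 2 * C" using ab[OF that] by auto
    have "\<bar>(p (b i) - p (a i)) + d i * (q (b i) - q (a i))\<bar> \<le> C"
      using ab[OF that] by (auto simp: algebra_simps abs_le_iff)
    moreover have "\<bar>d i * (q (b i) - q (a i))\<bar> \<le> \<bar>d i\<bar> * (2 * C)"
      unfolding abs_mult by (rule mult_left_mono[OF le]) simp
    ultimately have "\<bar>p (b i) - p (a i)\<bar> \<le> N" using N(1)[OF that] by linarith
    then show False using far[of "b i" "a i"] ab[OF that] le N(2) by force
  qed
  \<comment> \<open>a common upper endpoint would let the lower endpoint of edge \<open>j\<close> exceed the maximum for edge \<open>i\<close>\<close>
  have no_collision: "\<not> (b i = b j \<and> d i < d j)" if "i < k" "j < k" for i j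
  proof
    assume eq: "b i = b j \<and> d i < d j"
    let ?x = "q (a j) - q (b j)" and ?y = "p (a j) - p (b j)"
    have lo: "?y + d j * ?x \<ge> - C"
      using ab[OF \<open>j < k\<close>] by (auto simp: algebra_simps)
    have "?y + d i * ?x \<le> C"
      using ab[OF \<open>i < k\<close>] ab[OF \<open>j < k\<close>] eq by (auto simp: algebra_simps)
    then have "(d j - d i) * ?x \<ge> - 2 * C" using lo by (simp add: algebra_simps)
    moreover have "(d j - d i) * ?x \<le> 1 * ?x"
      using eq tall[OF \<open>j < k\<close>] \<open>C \<ge> 0\<close> by (intro mult_right_mono_neg) auto
    ultimately have "- 2 * C \<le> 1 * ?x" by (rule order_trans)
    then have "- 2 * C \<le> ?x" by (simp only: mult_1_left)
    moreover have "?x < - (2 * C)" using tall[OF \<open>j < k\<close>] by simp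
    ultimately show False by simp
  qed
  have "inj_on b {..<k}"
  proof (rule inj_onI)
    fix i j assume "i \<in> {..<k}" "j \<in> {..<k}" "b i = b j"
    then have "d i = d j" using no_collision[of i j] no_collision[of j i] by force
    then show "i = j" using d \<open>i \<in> _\<close> \<open>j \<in> _\<close> by (auto dest: inj_onD)
  qed
  then have "card (b ` {..<k}) = k" by (simp add: card_image)
  define l where "l = arg_min_on q I"
  have l: "l \<in> I" "\<And>s. s \<in> I \<Longrightarrow> q l \<le> q s"
    using arg_min_if_finite[OF I, of q] by (auto simp: l_def not_less)
  have "b i \<noteq> l" if "i < k" for i
    using tall[OF that] l(2)[of "a i"] ab[OF that] \<open>C \<ge> 0\<close> by auto
  then have "b ` {..<k} \<subset> I" using ab l(1) by blast
  then have "card (b ` {..<k}) < card I" using I by (intro psubset_card_mono)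
  then show ?thesis using \<open>card (b ` {..<k}) = k\<close> by simp
qed

text \<open>
  Every root of \<open>mixing_poly_root\<close> provides one instance of the hypothesis on edges: its valuation of
  the summand \<open>s\<close> is, up to an error bounded independently of \<open>n\<close>, the negative of
  \<open>fst (n s) + slope k i * snd (n s)\<close>.
\<close>

theorem few_far_monomials_independent:
  assumes k: "k \<ge> 1" and v: "laurent_eval v (mixing_poly k) = 0" "v \<noteq> 0"
    and I: "finite I" "I \<noteq> {}" "card I \<le> k"
    and S: "\<And>s. s \<in> I \<Longrightarrow> finite (S s)" "\<And>s. s \<in> I \<Longrightarrow> (\<Sum>m\<in>S s. monomial v m) \<noteq> 0"
  shows "\<exists>N. \<forall>n. (\<forall>s\<in>I. \<forall>t\<in>I. s \<noteq> t \<longrightarrow> n s - n t \<notin> {-N..N} \<times> {-N..N})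
    \<longrightarrow> (\<Sum>s\<in>I. \<Sum>m\<in>S s. monomial v (n s + m)) \<noteq> 0"
proof -
  have "\<exists>w. laurent_eval w (mixing_poly k) = 0 \<and> w \<noteq> 0 \<and> fls_subdegree w = - slope k i" if "i < k" for i
    using mixing_poly_root[OF that] by blast
  then obtain w where w: "\<And>i. i < k \<Longrightarrow> laurent_eval (w i) (mixing_poly k) = 0"
    "\<And>i. i < k \<Longrightarrow> w i \<noteq> 0" "\<And>i. i < k \<Longrightarrow> fls_subdegree (w i) = - slope k i"
    by metis
  define deg where "deg i s = fls_subdegree (\<Sum>m\<in>S s. monomial (w i) m)" for i s
  define D where "D = (\<Sum>i<k. \<Sum>s\<in>I. \<bar>deg i s\<bar>)"
  have D: "\<bar>deg i s\<bar> \<le> D" if "i < k" "s \<in> I" for i s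
  proof -
    have "\<bar>deg i s\<bar> \<le> (\<Sum>s\<in>I. \<bar>deg i s\<bar>)" by (rule member_le_sum) (use that I in auto)
    also have "\<dots> \<le> D" unfolding D_def
      by (rule member_le_sum) (use that in \<open>auto intro: sum_nonneg\<close>)
    finally show ?thesis .
  qed
  \<comment> \<open>valuations of the coefficients are at most \<open>D\<close> in absolute value, so two of them differ by at most \<open>C\<close>\<close>
  define C where "C = 2 * D"
  have "C \<ge> 0" by (auto simp: C_def D_def intro!: sum_nonneg)
  define E where "E = (\<Sum>i<k. \<bar>slope k i\<bar>)"
  have E: "\<bar>slope k i\<bar> \<le> E" if "i < k" for i
    unfolding E_def by (rule member_le_sum) (use that in auto)
  have "E \<ge> 0" by (auto simp: E_def intro!: sum_nonneg)
  define N where "N = 2 * C + E * (2 * C)"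
  have "(\<Sum>s\<in>I. \<Sum>m\<in>S s. monomial v (n s + m)) \<noteq> 0"
    if far: "\<forall>s\<in>I. \<forall>t\<in>I. s \<noteq> t \<longrightarrow> n s - n t \<notin> {-N..N} \<times> {-N..N}" for n
  proof
    assume 0: "(\<Sum>s\<in>I. \<Sum>m\<in>S s. monomial v (n s + m)) = 0"
    have "k < card I"
    proof (rule edges_need_points[where p = "\<lambda>s. fst (n s)" and q = "\<lambda>s. snd (n s)" and d = "slope k" and C = C and N = N])
      fix i assume i: "i < k"
      define z where "z s = monomial (w i) (n s) * (\<Sum>m\<in>S s. monomial (w i) m)" for s
      have nz: "(\<Sum>m\<in>S s. monomial (w i) m) \<noteq> 0" if "s \<in> I" for s
        using sum_monomial_conjugate[OF k w(1)[OF i] v(1) w(2)[OF i] v(2), of "S s" "\<lambda>m. m"] S that by auto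
      have "(\<Sum>a\<in>Sigma I S. monomial v (n (fst a) + snd a)) = 0"
        using 0 S(1) I(1) sum.Sigma[of I S "\<lambda>s m. monomial v (n s + m)"] by (simp add: case_prod_unfold)
      then have "(\<Sum>a\<in>Sigma I S. monomial (w i) (n (fst a) + snd a)) = 0"
        by (intro sum_monomial_conjugate[OF k v(1) w(1)[OF i] v(2) w(2)[OF i]]) (use S I in auto)
      then have "(\<Sum>s\<in>I. z s) = 0"
        using S(1) I(1) w(2)[OF i] by (simp add: z_def sum.Sigma case_prod_unfold sum_distrib_left monomial_add)
      moreover have znz: "z s \<noteq> 0" if "s \<in> I" for s
        using nz[OF that] monomial_nonzero[OF w(2)[OF i]] by (simp add: z_def)
      ultimately obtain a b where ab: "a \<in> I" "b \<in> I" "a \<noteq> b"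
        "\<And>s. s \<in> I \<Longrightarrow> fls_subdegree (z a) \<le> fls_subdegree (z s)"
        "\<And>s. s \<in> I \<Longrightarrow> fls_subdegree (z b) \<le> fls_subdegree (z s)"
        using fls_sum_zero_two_minimal[of I z] I by blast
      have zdeg: "fls_subdegree (z s) = deg i s - fst (n s) - slope k i * snd (n s)" if "s \<in> I" for s
        using nz[OF that] monomial_nonzero[OF w(2)[OF i]] w(2,3)[OF i]
        by (simp add: z_def deg_def monomial_subdegree)
      have "fst (n s) + slope k i * snd (n s) \<le> fst (n c) + slope k i * snd (n c) + C"
        if "s \<in> I" "c \<in> I" "fls_subdegree (z c) \<le> fls_subdegree (z s)" for s c
        using that(3) zdeg[OF that(1)] zdeg[OF that(2)] D[OF i that(1)] D[OF i that(2)]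
        by (auto simp: C_def abs_le_iff)
      then show "\<exists>a\<in>I. \<exists>b\<in>I. a \<noteq> b \<and>
         (\<forall>s\<in>I. fst (n s) + slope k i * snd (n s) \<le> fst (n a) + slope k i * snd (n a) + C) \<and>
         (\<forall>s\<in>I. fst (n s) + slope k i * snd (n s) \<le> fst (n b) + slope k i * snd (n b) + C)"
        using ab by blast
    next
      fix a b assume "a \<in> I" "b \<in> I" "a \<noteq> b"
      then have "n a - n b \<notin> {-N..N} \<times> {-N..N}" by (rule far[THEN bspec, THEN bspec, THEN mp])
      then show "N < \<bar>fst (n a) - fst (n b)\<bar> \<or> N < \<bar>snd (n a) - snd (n b)\<bar>"
        by (auto simp: mem_Times_iff)
    next
      fix i assume "i < k"
      then have "\<bar>slope k i\<bar> * (2 * C) \<le> E * (2 * C)" using E \<open>C \<ge> 0\<close> by (intro mult_right_mono) auto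
      then show "C + \<bar>slope k i\<bar> * (2 * C) \<le> N" using \<open>C \<ge> 0\<close> by (simp add: N_def)
    next
      show "2 * C \<le> N" using \<open>C \<ge> 0\<close> \<open>E \<ge> 0\<close> by (simp add: N_def)
    qed (use I slope_inj \<open>C \<ge> 0\<close> in auto)
    then show False using I by simp
  qed
  then show ?thesis by (intro exI[of _ N] allI impI)
qed

section \<open>The dual group\<close>

lemma sum_constant_parity:
  fixes c :: "'v::comm_monoid_add"
  assumes "c + c = 0" "finite B"
  shows "(\<Sum>b\<in>B. c) = (if odd (card B) then c else 0)"
  using assms(2) by (induction B rule: finite_induct) (simp_all add: assms(1))

text \<open>
  In characteristic two a sum over a family only sees the values taken an odd number of times;
  this reduces families with repetitions to sets.
\<close>

definition odd_values :: "('a \<Rightarrow> 'n) \<Rightarrow> 'a set \<Rightarrow> 'n set" where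
  "odd_values f A = {n \<in> f ` A. odd (card {a \<in> A. f a = n})}"

lemma sum_odd_values:
  fixes g :: "'n \<Rightarrow> 'v::comm_monoid_add"
  assumes "\<And>n. g n + g n = 0" "finite A"
  shows "(\<Sum>a\<in>A. g (f a)) = (\<Sum>n\<in>odd_values f A. g n)"
proof -
  have "(\<Sum>a\<in>A. g (f a)) = (\<Sum>n\<in>f ` A. \<Sum>a\<in>{a \<in> A. f a = n}. g (f a))"
    using assms(2) by (rule sum.image_gen)
  also have "\<dots> = (\<Sum>n\<in>f ` A. \<Sum>a\<in>{a \<in> A. f a = n}. g n)"
    by (intro sum.cong) auto
  also have "\<dots> = (\<Sum>n\<in>f ` A. if odd (card {a \<in> A. f a = n}) then g n else 0)"
    by (intro sum.cong) (use assms in \<open>simp_all add: sum_constant_parity\<close>)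
  also have "\<dots> = (\<Sum>n\<in>odd_values f A. g n)"
    unfolding odd_values_def using assms(2) by (intro sum.inter_filter[symmetric]) simp
  finally show ?thesis .
qed

lemma finite_odd_values [simp]: "finite A \<Longrightarrow> finite (odd_values f A)"
  by (simp add: odd_values_def)

lemma odd_values_subset: "odd_values f A \<subseteq> f ` A"
  by (auto simp: odd_values_def)

lemma bit_add_self: "(b::bit) + b = 0"
  by (cases b) simp_all

definition bit_int :: "bit \<Rightarrow> int" where
  "bit_int b = (if b = 1 then 1 else 0)"

lemma of_int_bit_int [simp]: "of_int (bit_int b) = b"
  by (cases b) (simp_all add: bit_int_def)

lemma bit_int_range: "bit_int b \<in> {0, 1}"
  by (simp add: bit_int_def)

lemma bit_int_of_int: "x \<in> {0, 1} \<Longrightarrow> bit_int (of_int x) = x"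
  by (auto simp: bit_int_def)

lemma even_iff_of_int_bit: "even (x::int) \<longleftrightarrow> of_int x = (0::bit)"
proof
  show "of_int x = (0::bit)" if "even x" using that by (auto elim!: evenE)
  show "even x" if "of_int x = (0::bit)" using that by (rule_tac ccontr) (auto elim!: oddE)
qed

lemma bit_int_add: "(bit_int a + bit_int b) mod 2 = bit_int (a + b)"
  by (cases a; cases b) (simp_all add: bit_int_def)

text \<open>
  Here \<open>\<phi>\<close> is a homomorphism from \<open>\<int> \<times> \<int>\<close> to the units of the Laurent series. The dual of the ring
  spanned by its values is realised inside \<open>{0, 1}\<close>-configurations on the lattice.
\<close>

locale dual_system =
  fixes \<phi> :: "int \<times> int \<Rightarrow> bit fls"
  assumes \<phi>_add: "\<phi> (m + n) = \<phi> m * \<phi> n" and \<phi>_zero: "\<phi> 0 = 1"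
begin

text \<open>
  Additive maps from the ring to the field with two elements, recorded by their values on the monomials:
  any configuration that respects the linear relations between the monomials.
\<close>

definition points :: "point set" where
  "points = {x. (\<forall>n. x n \<in> {0, 1}) \<and> (\<forall>S. finite S \<longrightarrow> (\<Sum>n\<in>S. \<phi> n) = 0 \<longrightarrow> even (\<Sum>n\<in>S. x n))}"

lemma \<phi>_nonzero: "\<phi> n \<noteq> 0"
  using \<phi>_add[of n "- n"] \<phi>_zero by auto

lemma pointsI:
  assumes "\<And>n. x n \<in> {0, 1}" "\<And>S. finite S \<Longrightarrow> (\<Sum>n\<in>S. \<phi> n) = 0 \<Longrightarrow> even (\<Sum>n\<in>S. x n)"
  shows "x \<in> points"
  unfolding points_def using assms by blast

lemma points_range: "x \<in> points \<Longrightarrow> x n \<in> {0, 1}"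
  unfolding points_def by blast

lemma points_even_family:
  assumes "x \<in> points" "finite A" "(\<Sum>a\<in>A. \<phi> (f a)) = 0"
  shows "even (\<Sum>a\<in>A. x (f a))"
proof -
  have "(\<Sum>n\<in>odd_values f A. \<phi> n) = 0"
    using assms sum_odd_values[of \<phi> A f] fls_bit_add_self by metis
  then have "even (\<Sum>n\<in>odd_values f A. x n)"
    using assms by (simp add: points_def)
  then have "(\<Sum>n\<in>odd_values f A. of_int (x n)) = (0::bit)"
    by (simp add: even_iff_of_int_bit)
  then have "(\<Sum>a\<in>A. of_int (x (f a))) = (0::bit)"
    using assms sum_odd_values[of "\<lambda>n. of_int (x n) :: bit" A f] bit_add_self by metis
  then show ?thesis by (simp add: even_iff_of_int_bit)
qed

text \<open>
  Reading off a fixed coefficient of a Laurent series is an additive map. These maps separate the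
  elements of the ring, which is all that is needed of Pontryagin duality.
\<close>

definition coefficient_point :: "int \<Rightarrow> point" where
  "coefficient_point c n = bit_int (fls_nth (\<phi> n) c)"

lemma coefficient_point_sum:
  "of_int (\<Sum>a\<in>A. coefficient_point c (f a)) = fls_nth (\<Sum>a\<in>A. \<phi> (f a)) c"
  by (simp add: coefficient_point_def fls_nth_sum)

lemma coefficient_point_in: "coefficient_point c \<in> points"
  unfolding points_def
  using bit_int_range coefficient_point_sum[of c "\<lambda>n. n"]
  by (auto simp: even_iff_of_int_bit coefficient_point_def simp del: of_int_sum)

lemma points_separate:
  assumes "(\<Sum>a\<in>A. \<phi> (f a)) \<noteq> 0"
  obtains x where "x \<in> points" "odd (\<Sum>a\<in>A. x (f a))"
proof -
  obtain c where "fls_nth (\<Sum>a\<in>A. \<phi> (f a)) c \<noteq> 0"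
    using assms by (meson nth_fls_subdegree_zero_iff)
  then have "odd (\<Sum>a\<in>A. coefficient_point c (f a))"
    unfolding even_iff_of_int_bit coefficient_point_sum .
  then show thesis using that coefficient_point_in by blast
qed

text \<open>
  The monomials, in a fixed enumeration, that are not sums of earlier ones form a basis of the
  ring over the field with two elements.
\<close>

definition basis :: "(int \<times> int) set" where
  "basis = {n. \<forall>R. finite R \<longrightarrow> (\<forall>r\<in>R. to_nat r < to_nat n) \<longrightarrow> \<phi> n \<noteq> (\<Sum>r\<in>R. \<phi> r)}"

lemma basis_spans: "\<exists>R. finite R \<and> R \<subseteq> basis \<and> \<phi> n = (\<Sum>r\<in>R. \<phi> r)"
proof (induction n rule: measure_induct_rule[of to_nat])
  case (less n)
  show ?case
  proof (cases "n \<in> basis")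
    case True
    then show ?thesis by (intro exI[of _ "{n}"]) simp
  next
    case False
    then obtain R where R: "finite R" "\<And>r. r \<in> R \<Longrightarrow> to_nat r < to_nat n" "\<phi> n = (\<Sum>r\<in>R. \<phi> r)"
      by (auto simp: basis_def)
    then have "\<forall>r\<in>R. \<exists>Q. finite Q \<and> Q \<subseteq> basis \<and> \<phi> r = (\<Sum>q\<in>Q. \<phi> q)"
      using less by blast
    then obtain Q where Q: "\<And>r. r \<in> R \<Longrightarrow> finite (Q r)" "\<And>r. r \<in> R \<Longrightarrow> Q r \<subseteq> basis"
      "\<And>r. r \<in> R \<Longrightarrow> \<phi> r = (\<Sum>q\<in>Q r. \<phi> q)"
      by metis
    have "\<phi> n = (\<Sum>r\<in>R. \<Sum>q\<in>Q r. \<phi> q)" unfolding R(3) by (intro sum.cong Q) simp_all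
    also have "\<dots> = (\<Sum>a\<in>Sigma R Q. \<phi> (snd a))"
      using R(1) Q(1) by (subst sum.Sigma) (auto simp: case_prod_unfold)
    also have "\<dots> = (\<Sum>q\<in>odd_values snd (Sigma R Q). \<phi> q)"
      using R(1) Q(1) by (intro sum_odd_values) (auto simp: fls_bit_add_self)
    finally have "\<phi> n = (\<Sum>q\<in>odd_values snd (Sigma R Q). \<phi> q)" .
    moreover have "odd_values snd (Sigma R Q) \<subseteq> basis"
      using odd_values_subset[of snd "Sigma R Q"] Q(2) by fastforce
    moreover have "finite (odd_values snd (Sigma R Q))" using R(1) Q(1) by auto
    ultimately show ?thesis by blast
  qed
qed

lemma basis_independent:
  assumes "finite F" "F \<subseteq> basis" "(\<Sum>n\<in>F. \<phi> n) = 0"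
  shows "F = {}"
proof (rule ccontr)
  assume "F \<noteq> {}"
  have "Max (to_nat ` F) \<in> to_nat ` F" using assms(1) \<open>F \<noteq> {}\<close> by simp
  then obtain n where "n \<in> F" "to_nat n = Max (to_nat ` F)" by auto
  then have n: "n \<in> F" "\<And>r. r \<in> F \<Longrightarrow> to_nat r \<le> to_nat n"
    using assms(1) by simp_all
  have "\<phi> n + (\<Sum>r\<in>F - {n}. \<phi> r) = 0"
    using assms n(1) by (simp add: sum.remove)
  then have "\<phi> n = (\<Sum>r\<in>F - {n}. \<phi> r)"
    by (metis fls_bit_uminus add_eq_0_iff)
  moreover have "to_nat r < to_nat n" if "r \<in> F - {n}" for r
    using n(2)[of r] that by (simp add: order_le_less)
  ultimately show False
    using n(1) assms(1,2) unfolding basis_def by blast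
qed

definition rep :: "int \<times> int \<Rightarrow> (int \<times> int) set" where
  "rep n = (if n \<in> basis then {n} else SOME R. finite R \<and> R \<subseteq> basis \<and> \<phi> n = (\<Sum>r\<in>R. \<phi> r))"

lemma rep: "finite (rep n)" "rep n \<subseteq> basis" "(\<Sum>r\<in>rep n. \<phi> r) = \<phi> n"
proof -
  have "finite (rep n) \<and> rep n \<subseteq> basis \<and> \<phi> n = (\<Sum>r\<in>rep n. \<phi> r)"
    using someI_ex[OF basis_spans[of n]] by (auto simp: rep_def)
  then show "finite (rep n)" "rep n \<subseteq> basis" "(\<Sum>r\<in>rep n. \<phi> r) = \<phi> n" by auto
qed

lemma sum_rep:
  fixes g :: "int \<times> int \<Rightarrow> 'v::comm_monoid_add"
  assumes "finite S" "\<And>b. g b + g b = 0"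
  shows "(\<Sum>n\<in>S. \<Sum>b\<in>rep n. g b) = (\<Sum>b\<in>odd_values snd (Sigma S rep). g b)"
proof -
  have "(\<Sum>n\<in>S. \<Sum>b\<in>rep n. g b) = (\<Sum>a\<in>Sigma S rep. g (snd a))"
    using assms rep(1) by (subst sum.Sigma) (auto simp: case_prod_unfold)
  also have "\<dots> = (\<Sum>b\<in>odd_values snd (Sigma S rep). g b)"
    using assms rep(1) by (intro sum_odd_values) auto
  finally show ?thesis .
qed

text \<open>
  A configuration on \<open>basis\<close> extends uniquely to an element of \<open>points\<close>; so the group is a product of
  two-element groups indexed by \<open>basis\<close>. The argument is a configuration on the whole lattice,
  so that a single product measure on the lattice induces Haar measure.
\<close>

definition extend :: "(int \<times> int \<Rightarrow> bit) \<Rightarrow> point" where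
  "extend y n = bit_int (\<Sum>b\<in>rep n. y b)"

lemma extend_in: "extend y \<in> points"
proof (rule pointsI)
  show "extend y n \<in> {0, 1}" for n by (simp only: extend_def bit_int_range)
  fix S :: "(int \<times> int) set" assume S: "finite S" "(\<Sum>n\<in>S. \<phi> n) = 0"
  let ?F = "odd_values snd (Sigma S rep)"
  have "(\<Sum>b\<in>?F. \<phi> b) = 0"
    using sum_rep[OF S(1), of \<phi>] S fls_bit_add_self by (simp add: rep(3))
  moreover have "?F \<subseteq> basis" using odd_values_subset[of snd "Sigma S rep"] rep(2) by fastforce
  moreover have "finite ?F" using S rep(1) by simp
  ultimately have "?F = {}" by (intro basis_independent)
  then have "(\<Sum>n\<in>S. \<Sum>b\<in>rep n. y b) = 0"
    using sum_rep[OF S(1), of y] bit_add_self by simp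
  then show "even (\<Sum>n\<in>S. extend y n)"
    by (simp add: even_iff_of_int_bit extend_def)
qed

lemma extend_restrict:
  assumes "x \<in> points"
  shows "extend (\<lambda>n. of_int (x n)) = x"
proof
  fix n
  have "(\<Sum>b\<in>rep n. of_int (x b)) = (of_int (x n) :: bit)"
  proof (cases "n \<in> basis")
    case True
    then show ?thesis by (simp add: rep_def)
  next
    case False
    then have n: "n \<notin> rep n" using rep(2) by blast
    then have "(\<Sum>r\<in>insert n (rep n). \<phi> r) = 0"
      using rep(1,3)[of n] by (simp add: fls_bit_add_self)
    then have "even (\<Sum>r\<in>insert n (rep n). x r)"
      using assms rep(1)[of n] by (simp add: points_def)
    then have "of_int (x n) + (\<Sum>b\<in>rep n. of_int (x b)) = (0::bit)"
      using n rep(1)[of n] by (simp add: even_iff_of_int_bit)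
    then show ?thesis by (cases "of_int (x n) :: bit"; cases "\<Sum>b\<in>rep n. of_int (x b) :: bit") simp_all
  qed
  then show "extend (\<lambda>n. of_int (x n)) n = x n"
    using bit_int_of_int[OF points_range[OF assms, of n]] by (simp add: extend_def)
qed

definition point_add :: "point \<Rightarrow> point \<Rightarrow> point" where
  "point_add x y = (\<lambda>n. (x n + y n) mod 2)"

lemma extend_add: "point_add (extend y) (extend z) = extend (\<lambda>n. y n + z n)"
  by (rule ext) (simp only: point_add_def extend_def bit_int_add sum.distrib)

lemma point_add_in: "x \<in> points \<Longrightarrow> y \<in> points \<Longrightarrow> point_add x y \<in> points"
  using extend_add extend_restrict extend_in by metis

lemma point_add_commute: "point_add x y = point_add y x"
  by (simp add: point_add_def add.commute)

lemma point_add_assoc: "point_add (point_add x y) z = point_add x (point_add y z)"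
  by (simp add: point_add_def fun_eq_iff mod_simps add.assoc)

lemma zero_in: "(\<lambda>_. 0) \<in> points"
  by (simp add: points_def)

lemma point_add_zero: "x \<in> points \<Longrightarrow> point_add (\<lambda>_. 0) x = x"
proof
  fix n assume "x \<in> points"
  from points_range[OF this, of n] show "point_add (\<lambda>_. 0) x n = x n" by (auto simp: point_add_def)
qed

lemma point_add_self: "point_add x x = (\<lambda>_. 0)"
  by (simp add: point_add_def fun_eq_iff)

definition shift :: "int \<times> int \<Rightarrow> point \<Rightarrow> point" where
  "shift m x = (\<lambda>n. x (n + m))"

lemma shift_in: "x \<in> points \<Longrightarrow> shift m x \<in> points"
proof -
  assume x: "x \<in> points"
  have "even (\<Sum>n\<in>S. x (n + m))" if "finite S" "(\<Sum>n\<in>S. \<phi> n) = 0" for S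
  proof (rule points_even_family[OF x that(1)])
    show "(\<Sum>n\<in>S. \<phi> (n + m)) = 0" using that(2) by (simp add: \<phi>_add flip: sum_distrib_right)
  qed
  then show ?thesis using points_range[OF x] by (intro pointsI) (simp_all only: shift_def)
qed

lemma shift_shift: "shift m (shift n x) = shift (m + n) x"
  by (simp add: shift_def add_ac)

lemma shift_zero: "shift 0 x = x"
  by (simp add: shift_def)

lemma shift_image: "A \<subseteq> points \<Longrightarrow> shift (- m) ` A = {x \<in> points. shift m x \<in> A}"
proof safe
  fix x assume "A \<subseteq> points" "x \<in> A"
  then show "shift (- m) x \<in> points" "shift m (shift (- m) x) \<in> A"
    by (auto simp: shift_in shift_shift shift_zero)
next
  fix x assume "shift m x \<in> A"
  then show "x \<in> shift (- m) ` A"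
    by (intro image_eqI[of _ _ "shift m x"]) (simp_all add: shift_shift shift_zero)
qed

lemma shift_point_add: "shift m (point_add x y) = point_add (shift m x) (shift m y)"
  by (simp add: shift_def point_add_def)

section \<open>Topology, group structure and action\<close>

abbreviation point_topology :: "point topology" where
  "point_topology \<equiv> top_of_set points"

definition point_group :: "point monoid" where
  "point_group = \<lparr>carrier = points, mult = point_add, one = (\<lambda>_. 0)\<rparr>"

lemma point_group_sel [simp]:
  "carrier point_group = points" "x \<otimes>\<^bsub>point_group\<^esub> y = point_add x y" "\<one>\<^bsub>point_group\<^esub> = (\<lambda>_. 0)"
  by (simp_all add: point_group_def)

lemma comm_group_point_group: "comm_group point_group"
proof (rule comm_groupI)
  fix x assume "x \<in> carrier point_group"
  then show "\<exists>y\<in>carrier point_group. y \<otimes>\<^bsub>point_group\<^esub> x = \<one>\<^bsub>point_group\<^esub>"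
    by (intro bexI[of _ x]) (simp_all add: point_add_self)
qed (simp_all add: point_add_in zero_in point_add_assoc point_add_zero, rule point_add_commute)

lemma inv_point_group:
  assumes "x \<in> points"
  shows "inv\<^bsub>point_group\<^esub> x = x"
proof -
  interpret comm_group point_group by (rule comm_group_point_group)
  show ?thesis by (rule inv_equality) (simp_all add: assms point_add_self)
qed

lemma closed_points: "closed points"
proof -
  have "points = (\<Inter>n. {x. x n \<in> {0, 1}}) \<inter>
      (\<Inter>S\<in>{S. finite S \<and> (\<Sum>n\<in>S. \<phi> n) = 0}. {x. (\<Sum>n\<in>S. x n) \<in> {k. even k}})"
    unfolding points_def by auto
  moreover have "closed ((\<lambda>x::point. x n) -` {0, 1})" for n
    by (rule closed_vimage) simp_all
  moreover have "closed ((\<lambda>x::point. \<Sum>n\<in>S. x n) -` {k. even k})" for S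
    by (rule closed_vimage) (auto intro!: continuous_on_sum simp: closed_def discrete_topology_class.open_discrete)
  ultimately show ?thesis
    by (auto simp: vimage_def intro!: closed_Int closed_INT)
qed

lemma compact_points: "compact points"
proof -
  have "compact (\<Pi>\<^sub>E n\<in>UNIV. {0, 1} :: point set)"
  proof -
    have "compactin (product_topology (\<lambda>_. euclidean) UNIV) (\<Pi>\<^sub>E n\<in>UNIV. {0, 1} :: point set)"
      by (simp add: compactin_PiE)
    then show ?thesis by (metis euclidean_product_topology compactin_euclidean_iff)
  qed
  moreover have "points = points \<inter> (\<Pi>\<^sub>E n\<in>UNIV. {0, 1})"
    using points_range by (auto simp: PiE_def)
  ultimately show ?thesis using closed_points by (metis closed_Int_compact)
qed

lemma metrizable_point_topology: "metrizable_space point_topology"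
proof -
  have "euclidean = discrete_topology (UNIV :: int set)"
    by (simp add: topology_eq discrete_topology_class.open_discrete)
  then have "metrizable_space (euclidean :: int topology)" by (metis metrizable_space_discrete_topology)
  then have "metrizable_space (product_topology (\<lambda>_::int \<times> int. euclidean :: int topology) UNIV)"
    by (subst metrizable_space_product_topology) auto
  then show ?thesis
    unfolding euclidean_product_topology[symmetric] by (rule metrizable_space_subtopology)
qed

lemma continuous_point_add: "continuous_on A (\<lambda>(x, y). point_add x y)"
proof -
  have "continuous_on A (\<lambda>p. (fst p n + snd p n) mod 2 :: int)" for n :: "int \<times> int" and A :: "(point \<times> point) set"
  proof (rule continuous_on_compose2[where g = "\<lambda>k. k mod 2" and t = UNIV])
    show "continuous_on A (\<lambda>p. fst p n + snd p n)"
      by (intro continuous_on_add continuous_on_product_then_coordinatewise[OF continuous_on_fst[OF continuous_on_id]]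
          continuous_on_product_then_coordinatewise[OF continuous_on_snd[OF continuous_on_id]])
  qed simp_all
  then show ?thesis
    unfolding point_add_def case_prod_unfold by (intro continuous_on_coordinatewise_then_product)
qed

lemma continuous_shift: "continuous_on A (shift m)"
  unfolding shift_def
  by (rule continuous_on_coordinatewise_then_product)
     (rule continuous_on_product_then_coordinatewise[OF continuous_on_id])

lemma algebraic_Z2_action_shift: "algebraic_Z2_action point_group point_topology shift"
proof -
  interpret comm_group point_group by (rule comm_group_point_group)
  show ?thesis
  proof unfold_locales
    show "continuous_map (prod_topology point_topology point_topology) point_topology (\<lambda>(x, y). x \<otimes>\<^bsub>point_group\<^esub> y)"
      using continuous_point_add point_add_in by (auto simp: prod_topology_subtopology_eu)
    have "continuous_map point_topology point_topology (\<lambda>x. x)" by simp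
    then show "continuous_map point_topology point_topology (\<lambda>x. inv\<^bsub>point_group\<^esub> x)"
      by (rule continuous_map_eq) (simp add: inv_point_group)
    show "compact_space point_topology"
      using compact_points by (simp add: compact_space_subtopology)
    show "metrizable_space point_topology" by (rule metrizable_point_topology)
    obtain x where "x \<in> points" "odd (\<Sum>a\<in>{0::int \<times> int}. x a)"
      using points_separate[of "\<lambda>n. n" "{0}"] \<phi>_zero by auto
    then show "carrier point_group \<noteq> {\<one>\<^bsub>point_group\<^esub>}" by auto
    show "continuous_map point_topology point_topology (shift n)" for n
      using continuous_shift shift_in by auto
    show "shift n \<in> iso point_group point_group" for n
    proof (rule isoI)
      show "shift n \<in> hom point_group point_group"
        by (rule homI) (simp_all add: shift_in shift_point_add)
      show "bij_betw (shift n) (carrier point_group) (carrier point_group)"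
        by (rule bij_betw_byWitness[where f' = "shift (- n)"])
           (auto simp: shift_in shift_shift shift_zero)
    qed
  qed (simp_all add: shift_zero shift_shift)
qed

section \<open>Borel sets and Haar measure\<close>

definition borel_points :: "point measure" where
  "borel_points = restrict_space borel points"

lemma space_borel_points [simp]: "space borel_points = points"
  by (simp add: borel_points_def space_restrict_space)

text \<open>
  The Borel sets of the subspace are the traces of the Borel sets of the space of all configurations;
  the latter description is the convenient one for measurability.
\<close>

lemma borel_points_openin: "sets borel_points = sets (sigma (topspace point_topology) {U. openin point_topology U})"
proof
  let ?M = "sigma points {U. openin point_topology U}"
  have sub: "{U. openin point_topology U} \<subseteq> Pow points"
    by (metis PowI mem_Collect_eq openin_subset subsetI topspace_euclidean_subtopology)
  have "(\<lambda>x. x) \<in> measurable ?M borel"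
  proof (rule borel_measurableI)
    fix S :: "point set" assume "open S"
    then have "openin point_topology (S \<inter> points)" unfolding openin_open by (metis Int_commute)
    then show "(\<lambda>x. x) -` S \<inter> space ?M \<in> sets ?M"
      by (simp add: space_measure_of[OF sub] sets_measure_of[OF sub] sigma_sets.Basic)
  qed
  then have "B \<inter> points \<in> sets ?M" if "B \<in> sets borel" for B
    using measurable_sets[of "\<lambda>x. x" ?M borel B] that by (simp add: space_measure_of[OF sub])
  then show "sets borel_points \<subseteq> sets (sigma (topspace point_topology) {U. openin point_topology U})"
    unfolding borel_points_def sets_restrict_space by (auto simp: Int_commute)
  have "sigma_sets points {U. openin point_topology U} \<subseteq> sets borel_points"
  proof (rule sets.sigma_sets_subset')
    show "{U. openin point_topology U} \<subseteq> sets borel_points"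
      unfolding borel_points_def sets_restrict_space openin_open by (auto intro!: imageI)
    show "points \<in> sets borel_points" using sets.top[of borel_points] by simp
  qed
  then show "sets (sigma (topspace point_topology) {U. openin point_topology U}) \<subseteq> sets borel_points"
    by (simp add: sets_measure_of[OF sub])
qed

definition cylinder :: "(int \<times> int) set \<Rightarrow> point \<Rightarrow> point set" where
  "cylinder F c = {x \<in> points. \<forall>n\<in>F. x n = c n}"

lemma measurable_coordinate: "(\<lambda>x. x n) \<in> measurable borel_points (count_space UNIV)"
proof -
  have "(\<lambda>x::point. x n) \<in> measurable borel borel" by (rule measurable_product_coordinates)
  then have "(\<lambda>x::point. x n) \<in> measurable borel_points borel"
    unfolding borel_points_def by (rule measurable_restrict_space1)
  then have "(\<lambda>x. x n) -` A \<inter> points \<in> sets borel_points" for A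
    using measurable_sets[of "\<lambda>x. x n" borel_points borel A] discrete_topology_class.open_discrete[of A] by auto
  then show ?thesis by (intro measurableI) auto
qed

lemma cylinder_in_sets: "finite F \<Longrightarrow> cylinder F c \<in> sets borel_points"
proof -
  assume F: "finite F"
  have "{x \<in> space borel_points. x n = c n} \<in> sets borel_points" for n
    using measurable_sets[OF measurable_coordinate[of n], of "{c n}"]
    by (simp add: vimage_def Int_def conj_commute)
  then have "{x \<in> space borel_points. \<forall>n\<in>F. x n = c n} \<in> sets borel_points"
    using F by (intro sets.sets_Collect_finite_All)
  then show ?thesis by (simp add: cylinder_def)
qed

end

instance int :: second_countable_topology
proof
  have "generate_topology (range (\<lambda>n::int. {n})) S" for S
  proof -
    have "generate_topology (range (\<lambda>n::int. {n})) (\<Union>((\<lambda>n. {n}) ` S))"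
      by (rule generate_topology.UN) (auto intro: generate_topology.Basis)
    then show ?thesis by simp
  qed
  then show "\<exists>B::int set set. countable B \<and> open = generate_topology B"
    by (intro exI[of _ "range (\<lambda>n. {n})"]) (auto simp: fun_eq_iff discrete_topology_class.open_discrete)
qed

context dual_system
begin

lemma measurable_into_points:
  assumes "\<And>w. w \<in> space M \<Longrightarrow> f w \<in> points" "\<And>n. (\<lambda>w. f w n) \<in> measurable M (count_space UNIV)"
  shows "f \<in> measurable M borel_points"
proof -
  have "(\<lambda>w. f w n) \<in> measurable M borel" for n
    by (rule measurable_compose[OF assms(2)]) simp
  then have "(\<lambda>w n. f w n) \<in> measurable M (Pi\<^sub>M UNIV (\<lambda>_. borel))"
    by (intro measurable_PiM_single') auto
  moreover have "measurable M (Pi\<^sub>M UNIV (\<lambda>_::int \<times> int. borel :: int measure)) = measurable M borel"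
    by (rule measurable_cong_sets) (rule refl, rule sets_PiM_equal_borel)
  ultimately have "f \<in> measurable M borel" by simp
  then show ?thesis
    unfolding borel_points_def using assms(1) by (intro measurable_restrict_space2) auto
qed

text \<open>
  A countable product of second countable spaces has as Borel sets the product \<open>\<sigma>\<close>-algebra, which the
  coordinates generate.
\<close>

lemma sets_borel_points: "sets borel_points = sigma_sets points {cylinder F c |F c. finite F}"
proof
  let ?C = "{cylinder F c |F c. finite F}" and ?M = "sigma points {cylinder F c |F c. finite F}"
  have sub: "?C \<subseteq> Pow points" by (auto simp: cylinder_def)
  have "(\<lambda>x. x) \<in> measurable ?M borel_points"
  proof (rule measurable_into_points)
    fix n
    have "(\<lambda>x. x n) -` {a} \<inter> points \<in> sigma_sets points ?C" for a
    proof -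
      have "(\<lambda>x. x n) -` {a} \<inter> points = cylinder {n} (\<lambda>_. a)" by (auto simp: cylinder_def)
      then show ?thesis by (auto intro!: sigma_sets.Basic)
    qed
    then have "(\<lambda>x. x n) -` {a} \<inter> space ?M \<in> sets ?M" for a
      unfolding space_measure_of[OF sub] sets_measure_of[OF sub] .
    then show "(\<lambda>x. x n) \<in> measurable ?M (count_space UNIV)"
      by (subst measurable_count_space_eq2_countable) simp_all
  qed (simp only: space_measure_of[OF sub])
  then have "(\<lambda>x. x) -` B \<inter> space ?M \<in> sets ?M" if "B \<in> sets borel_points" for B
    using that by (rule measurable_sets)
  moreover have "(\<lambda>x. x) -` B \<inter> space ?M = B" if "B \<in> sets borel_points" for B
    unfolding space_measure_of[OF sub] using sets.sets_into_space[OF that] by auto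
  ultimately show "sets borel_points \<subseteq> sigma_sets points ?C"
    unfolding sets_measure_of[OF sub] by fastforce
  show "sigma_sets points ?C \<subseteq> sets borel_points"
    using sets.top[of borel_points] cylinder_in_sets by (intro sets.sigma_sets_subset') auto
qed

lemma Int_stable_cylinders: "Int_stable {cylinder F c |F c. finite F}"
proof (rule Int_stableI)
  fix A B assume "A \<in> {cylinder F c |F c. finite F}" "B \<in> {cylinder F c |F c. finite F}"
  then obtain F c G d where AB: "A = cylinder F c" "B = cylinder G d" "finite F" "finite G" by auto
  show "A \<inter> B \<in> {cylinder F c |F c. finite F}"
  proof (cases "A \<inter> B = {}")
    case True
    \<comment> \<open>points take only the values \<open>0\<close> and \<open>1\<close>, so prescribing \<open>2\<close> presents the empty set as a cylinder\<close>
    moreover have "cylinder {0} (\<lambda>_. 2) = {}"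
      by (auto simp: cylinder_def dest: points_range[where n = 0])
    ultimately show ?thesis by (metis (mono_tags, lifting) finite.emptyI finite.insertI mem_Collect_eq)
  next
    case False
    then obtain x where "x \<in> A" "x \<in> B" by auto
    then have "A \<inter> B = cylinder (F \<union> G) x" by (auto simp: AB cylinder_def)
    then show ?thesis using AB by blast
  qed
qed

definition coin :: "bit measure" where
  "coin = measure_pmf (pmf_of_set {0, 1})"

lemma bit_UNIV: "(UNIV :: bit set) = {0, 1}"
  using bit_not_zero_iff by auto

lemma coin_invariant: "emeasure coin {v. v + c \<in> F} = emeasure coin F"
proof -
  have "map_pmf (\<lambda>v. v + c) (pmf_of_set {0, 1}) = pmf_of_set ((\<lambda>v. v + c) ` {0, 1})"
    by (rule map_pmf_of_set_inj) (auto intro: inj_onI)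
  also have "(\<lambda>v. v + c) ` {0, 1} = {0, 1}" by (cases c) auto
  finally have "emeasure (measure_pmf (pmf_of_set {0, 1})) F = emeasure (measure_pmf (map_pmf (\<lambda>v. v + c) (pmf_of_set {0, 1}))) F"
    by simp
  then show ?thesis by (simp add: coin_def vimage_def)
qed

definition coin_space :: "(int \<times> int \<Rightarrow> bit) measure" where
  "coin_space = Pi\<^sub>M UNIV (\<lambda>_. coin)"

lemma space_coin [simp]: "space coin = UNIV" and sets_coin [simp]: "sets coin = UNIV"
  by (simp_all add: coin_def)

lemma space_coin_space [simp]: "space coin_space = UNIV"
  by (simp add: coin_space_def space_PiM)

lemma prob_space_coin: "prob_space coin"
  by (simp add: coin_def prob_space_measure_pmf)

lemma measurable_coin_coordinate: "(\<lambda>y. y n) \<in> measurable coin_space (count_space UNIV)"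
proof -
  have "(\<lambda>y. y n) \<in> measurable coin_space coin"
    unfolding coin_space_def by (rule measurable_component_singleton) simp
  then show ?thesis by (simp add: measurable_cong_sets[of coin_space coin_space coin "count_space UNIV"])
qed

lemma measurable_coin_translate: "(\<lambda>y n. c n + y n) \<in> measurable coin_space coin_space"
proof -
  have "(\<lambda>y. c n + y n) \<in> measurable coin_space coin" for n
  proof -
    have "(\<lambda>y. c n + y n) \<in> measurable coin_space (count_space UNIV)"
      by (rule measurable_compose[OF measurable_coin_coordinate]) simp
    then show ?thesis by (simp add: measurable_cong_sets[of coin_space coin_space coin "count_space UNIV"])
  qed
  then show ?thesis
    unfolding coin_space_def by (intro measurable_PiM_single') auto
qed

text \<open>
  A translation acts on each coordinate separately and preserves the fair coin.
\<close>

lemma coin_space_translate: "distr coin_space coin_space (\<lambda>y n. c n + y n) = coin_space"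
proof -
  interpret prob_space coin by (rule prob_space_coin)
  interpret product_prob_space "\<lambda>_. coin" "UNIV :: (int \<times> int) set" by unfold_locales
  show ?thesis
    unfolding coin_space_def
  proof (rule PiM_eq, unfold coin_space_def[symmetric])
    fix J :: "(int \<times> int) set" and F :: "int \<times> int \<Rightarrow> bit set" assume J: "finite J" "J \<subseteq> UNIV"
    have emb: "prod_emb UNIV (\<lambda>_. coin) J (Pi\<^sub>E J E) = {y. \<forall>j\<in>J. y j \<in> E j}" for E
      by (auto simp: prod_emb_def space_PiM PiE_iff)
    have in_sets: "{y. \<forall>j\<in>J. y j \<in> E j} \<in> sets coin_space" for E
      unfolding emb[symmetric] coin_space_def using J by (intro sets_PiM_I) auto
    have val: "emeasure coin_space {y. \<forall>j\<in>J. y j \<in> E j} = (\<Prod>j\<in>J. emeasure coin (E j))" for E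
      unfolding emb[symmetric] coin_space_def using J by (intro emeasure_PiM_emb) auto
    have "emeasure (distr coin_space coin_space (\<lambda>y n. c n + y n)) {y. \<forall>j\<in>J. y j \<in> F j}
        = emeasure coin_space {y. \<forall>j\<in>J. y j \<in> {v. v + c j \<in> F j}}"
      unfolding emeasure_distr[OF measurable_coin_translate in_sets]
      by (simp only: vimage_def mem_Collect_eq space_coin_space Int_UNIV_right add.commute)
    also have "\<dots> = (\<Prod>j\<in>J. emeasure coin (F j))"
      unfolding val coin_invariant ..
    finally show "emeasure (distr coin_space coin_space (\<lambda>y n. c n + y n)) (prod_emb UNIV (\<lambda>_. coin) J (Pi\<^sub>E J F))
        = (\<Prod>j\<in>J. emeasure coin (F j))" unfolding emb .
  qed simp
qed

lemma measurable_coin_sum: "finite R \<Longrightarrow> (\<lambda>y. \<Sum>b\<in>R. y b) \<in> measurable coin_space (count_space UNIV)"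
proof (induction R rule: finite_induct)
  case (insert b R)
  have "(\<lambda>y. y b + (\<Sum>b\<in>R. y b)) \<in> measurable coin_space (count_space UNIV)"
  proof (rule measurable_compose_countable'[where f = "\<lambda>i y. y b + i" and I = UNIV, OF _ insert.IH])
    show "(\<lambda>y. y b + i) \<in> measurable coin_space (count_space UNIV)" for i
      by (rule measurable_compose[OF measurable_coin_coordinate]) simp
    show "countable (UNIV :: bit set)" by (simp add: bit_UNIV)
  qed
  then show ?case using insert.hyps by simp
qed simp

lemma measurable_extend: "extend \<in> measurable coin_space borel_points"
proof (rule measurable_into_points)
  show "(\<lambda>y. extend y n) \<in> measurable coin_space (count_space UNIV)" for n
    unfolding extend_def by (rule measurable_compose[OF measurable_coin_sum[OF rep(1)]]) simp
qed (rule extend_in)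

text \<open>
  Haar measure makes the values on \<open>basis\<close> independent fair coins.
\<close>

definition haar :: "point measure" where
  "haar = distr coin_space borel_points extend"

lemma space_haar [simp]: "space haar = points" and sets_haar: "sets haar = sets borel_points"
  by (simp_all add: haar_def)

lemma measurable_haar: "measurable haar N = measurable borel_points N"
  by (rule measurable_cong_sets) (simp_all add: sets_haar)

lemma prob_space_haar: "prob_space haar"
proof -
  have "prob_space coin_space"
    unfolding coin_space_def by (intro prob_space_PiM prob_space_coin)
  then show ?thesis unfolding haar_def by (rule prob_space.prob_space_distr) (rule measurable_extend)
qed

lemma measurable_point_add:
  assumes "g \<in> points"
  shows "point_add g \<in> measurable borel_points borel_points"
proof (rule measurable_into_points)
  show "(\<lambda>x. point_add g x n) \<in> measurable borel_points (count_space UNIV)" for n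
    unfolding point_add_def
    by (rule measurable_compose[OF measurable_coordinate, where g = "\<lambda>k. (g n + k) mod 2"]) simp
qed (use assms point_add_in in simp)

lemma measurable_shift: "shift m \<in> measurable borel_points borel_points"
  by (rule measurable_into_points) (simp_all add: shift_in, simp add: shift_def measurable_coordinate)

text \<open>
  Translation by \<open>g\<close> corresponds under \<open>extend\<close> to translation by the restriction of \<open>g\<close>.
\<close>

lemma haar_translate:
  assumes "g \<in> points"
  shows "distr haar borel_points (point_add g) = haar"
proof -
  let ?t = "\<lambda>y n. of_int (g n) + y n"
  have "point_add g \<circ> extend = extend \<circ> ?t"
    using extend_add[of "\<lambda>n. of_int (g n)"] extend_restrict[OF assms] by (auto simp: fun_eq_iff)
  then have "distr haar borel_points (point_add g) = distr coin_space borel_points (extend \<circ> ?t)"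
    unfolding haar_def by (simp add: distr_distr measurable_point_add[OF assms] measurable_extend)
  also have "\<dots> = distr (distr coin_space coin_space ?t) borel_points extend"
    by (rule distr_distr[symmetric]) (rule measurable_extend, rule measurable_coin_translate)
  finally show ?thesis by (simp only: coin_space_translate haar_def)
qed

lemma haar_probability_haar: "haar_probability point_group point_topology haar"
  unfolding haar_probability_def
proof (intro conjI ballI)
  show "prob_space haar" by (rule prob_space_haar)
  show "sets haar = sets (sigma (topspace point_topology) {U. openin point_topology U})"
    unfolding sets_haar by (rule borel_points_openin)
  fix g A assume "g \<in> carrier point_group" and A: "A \<in> sets haar"
  then have g: "g \<in> points" by simp
  have sub: "A \<subseteq> points" using sets.sets_into_space[OF A] by simp
  have inv: "point_add g (point_add g x) = x" if "x \<in> points" for x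
    using that by (simp add: point_add_self point_add_zero flip: point_add_assoc)
  have "point_add g ` A = point_add g -` A \<inter> points"
  proof (intro equalityI subsetI)
    fix x assume "x \<in> point_add g -` A \<inter> points"
    then show "x \<in> point_add g ` A" by (intro image_eqI[of _ _ "point_add g x"]) (auto simp: inv)
  qed (use sub g point_add_in inv in auto)
  then have "measure haar (point_add g ` A) = measure (distr haar borel_points (point_add g)) A"
    using A measurable_point_add[OF g] by (simp add: measure_distr measurable_haar sets_haar)
  then show "measure haar ((\<lambda>x. g \<otimes>\<^bsub>point_group\<^esub> x) ` A) = measure haar A"
    by (simp add: haar_translate[OF g])
qed

end

section \<open>Characters\<close>

definition parity_sign :: "int \<Rightarrow> real" where
  "parity_sign k = (if even k then 1 else - 1)"

lemma parity_sign_add: "parity_sign (a + b) = parity_sign a * parity_sign b"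
  by (simp add: parity_sign_def)

lemma parity_sign_0 [simp]: "parity_sign 0 = 1"
  by (simp add: parity_sign_def)

lemma parity_sign_sum: "parity_sign (\<Sum>a\<in>A. k a) = (\<Prod>a\<in>A. parity_sign (k a))"
  by (induction A rule: infinite_finite_induct) (simp_all add: parity_sign_add)

lemma parity_sign_mod: "parity_sign (k mod 2) = parity_sign k"
  by (simp add: parity_sign_def)

lemma abs_parity_sign [simp]: "\<bar>parity_sign k\<bar> = 1"
  by (simp add: parity_sign_def)

text \<open>
  The indexed form allows repeated lattice points, as they occur in products of shifted characters.
\<close>

definition character :: "('n \<Rightarrow> int \<times> int) \<Rightarrow> 'n set \<Rightarrow> point \<Rightarrow> real" where
  "character f A x = parity_sign (\<Sum>a\<in>A. x (f a))"

lemma abs_character [simp]: "\<bar>character f A x\<bar> = 1"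
  by (simp add: character_def)

context dual_system
begin

lemma measurable_character: "character f A \<in> borel_measurable borel_points"
proof -
  have "(\<lambda>x. parity_sign (x n)) \<in> borel_measurable borel_points" for n
    by (rule measurable_compose[OF measurable_coordinate]) simp
  then show ?thesis
    unfolding character_def parity_sign_sum by (intro borel_measurable_prod)
qed

lemma integrable_haar_bounded:
  assumes "f \<in> borel_measurable borel_points" "\<And>x. x \<in> points \<Longrightarrow> \<bar>f x\<bar> \<le> (B::real)"
  shows "integrable haar f"
proof -
  interpret prob_space haar by (rule prob_space_haar)
  show ?thesis
    by (rule integrable_const_bound[of _ B, OF AE_I2]) (use assms in \<open>simp_all add: measurable_haar\<close>)
qed

text \<open>
  If the ring element is nonzero, translation by a point at which the character is \<open>- 1\<close> negates the
  integral without changing it.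
\<close>

lemma integral_character:
  assumes "finite A"
  shows "(\<integral>x. character f A x \<partial>haar) = (if (\<Sum>a\<in>A. \<phi> (f a)) = 0 then 1 else 0)"
proof (cases "(\<Sum>a\<in>A. \<phi> (f a)) = 0")
  case True
  interpret prob_space haar by (rule prob_space_haar)
  have "(\<integral>x. character f A x \<partial>haar) = (\<integral>x. 1 \<partial>haar)"
    by (rule Bochner_Integration.integral_cong)
       (use points_even_family[OF _ assms True] in \<open>simp_all add: character_def parity_sign_def\<close>)
  then show ?thesis using True prob_space by simp
next
  case False
  then obtain y where y: "y \<in> points" "odd (\<Sum>a\<in>A. y (f a))" by (rule points_separate)
  have flip: "character f A (point_add y x) = - character f A x" for x
  proof -
    have "character f A (point_add y x) = parity_sign ((\<Sum>a\<in>A. y (f a)) + (\<Sum>a\<in>A. x (f a)))"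
      unfolding character_def parity_sign_sum parity_sign_add prod.distrib[symmetric]
      by (simp add: point_add_def parity_sign_mod parity_sign_add)
    then show ?thesis using y(2) by (simp add: character_def parity_sign_def)
  qed
  have "(\<integral>x. character f A x \<partial>haar) = (\<integral>x. character f A x \<partial>distr haar borel_points (point_add y))"
    using haar_translate[OF y(1)] by simp
  also have "\<dots> = (\<integral>x. character f A (point_add y x) \<partial>haar)"
    by (rule integral_distr) (simp_all add: measurable_haar measurable_point_add[OF y(1)] measurable_character)
  also have "\<dots> = - (\<integral>x. character f A x \<partial>haar)" by (simp add: flip)
  finally show ?thesis using False by simp
qed

text \<open>
  Expanding the product over \<open>F\<close> gives a linear combination of characters. The induction carries an
  additional character along, whose support is disjoint from \<open>F\<close>.
\<close>

lemma cylinder_in_span: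
  fixes V :: "(point \<Rightarrow> real) set"
  assumes char: "\<And>S. finite S \<Longrightarrow> character (\<lambda>n. n) S \<in> V"
    and add: "\<And>f g. f \<in> V \<Longrightarrow> g \<in> V \<Longrightarrow> (\<lambda>x. f x + g x) \<in> V"
    and scale: "\<And>f c. f \<in> V \<Longrightarrow> (\<lambda>x. c * f x) \<in> V"
    and "finite F"
  shows "(\<lambda>x. \<Prod>n\<in>F. (1 + e n * parity_sign (x n)) / 2) \<in> V"
proof -
  have "(\<lambda>x. character (\<lambda>n. n) S x * (\<Prod>n\<in>F. (1 + e n * parity_sign (x n)) / 2)) \<in> V"
    if "finite S" "S \<inter> F = {}" for S
    using \<open>finite F\<close> that
  proof (induction F arbitrary: S rule: finite_induct)
    case (insert n F)
    let ?p = "\<lambda>x. \<Prod>n\<in>F. (1 + e n * parity_sign (x n)) / 2"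
    have "character (\<lambda>n. n) S x * (\<Prod>n\<in>insert n F. (1 + e n * parity_sign (x n)) / 2)
        = 1 / 2 * (character (\<lambda>n. n) S x * ?p x) + e n / 2 * (character (\<lambda>n. n) (insert n S) x * ?p x)" for x
      using insert.hyps insert.prems
      by (simp add: character_def parity_sign_add field_simps)
    moreover have "(\<lambda>x. character (\<lambda>n. n) S x * ?p x) \<in> V"
      using insert.prems by (intro insert.IH) auto
    moreover have "(\<lambda>x. character (\<lambda>n. n) (insert n S) x * ?p x) \<in> V"
      using insert.prems insert.hyps by (intro insert.IH) auto
    ultimately show ?case
      by (simp only: add scale)
  qed (use char in simp)
  from this[of "{}"] show ?thesis by (simp add: character_def)
qed

lemma indicator_cylinder:
  assumes "finite F" "x \<in> points" "\<And>n. n \<in> F \<Longrightarrow> c n \<in> {0, 1}"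
  shows "indicator (cylinder F c) x = (\<Prod>n\<in>F. (1 + parity_sign (c n) * parity_sign (x n)) / 2)"
proof -
  have one: "(1 + parity_sign (c n) * parity_sign (x n)) / 2 = (if x n = c n then 1 else 0)" if "n \<in> F" for n
    using assms(3)[OF that] points_range[OF assms(2), of n] by (auto simp: parity_sign_def)
  have "(\<Prod>n\<in>F. (1 + parity_sign (c n) * parity_sign (x n)) / 2) = (\<Prod>n\<in>F. if x n = c n then 1 else 0)"
    by (rule prod.cong) (simp_all add: one)
  also have "\<dots> = (if \<forall>n\<in>F. x n = c n then 1 else 0)"
    using assms(1) by (auto intro!: prod_zero)
  finally show ?thesis using assms(2) by (simp add: cylinder_def indicator_def)
qed

lemma cylinder_cases:
  assumes "finite F"
  obtains "cylinder F c = {}" | "\<And>n. n \<in> F \<Longrightarrow> c n \<in> {0, 1}"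
proof (cases "\<forall>n\<in>F. c n \<in> {0, 1}")
  case False
  then obtain n where "n \<in> F" "c n \<notin> {0, 1}" by auto
  then have "cylinder F c = {}" using points_range[of _ n] by (fastforce simp: cylinder_def)
  then show thesis by (rule that(1))
qed (use that(2) in blast)

text \<open>
  The functions with the limit property form a vector space containing the characters, hence the
  indicators of cylinders, which generate the Borel sets. For disjoint unions the limit is interchanged with
  the series by Tannery's theorem; the maps \<open>T j\<close> not increasing the measure is what dominates the terms.
\<close>

lemma indicator_limit_from_characters:
  fixes G :: "nat \<Rightarrow> point \<Rightarrow> real" and T :: "nat \<Rightarrow> point \<Rightarrow> point"
  assumes T: "\<And>j. T j \<in> measurable borel_points borel_points"
    and inv: "\<And>j A. A \<in> sets borel_points \<Longrightarrow> measure haar (T j -` A \<inter> points) \<le> measure haar A"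
    and G: "\<And>j. G j \<in> borel_measurable borel_points" "\<And>j x. x \<in> points \<Longrightarrow> \<bar>G j x\<bar> \<le> 1"
    and char: "\<And>S. finite S \<Longrightarrow> (\<lambda>j. \<integral>x. character (\<lambda>n. n) S (T j x) * G j x \<partial>haar)
        \<longlonglongrightarrow> c * (\<integral>x. character (\<lambda>n. n) S x \<partial>haar)"
    and A: "A \<in> sets borel_points"
  shows "(\<lambda>j. \<integral>x. indicator A (T j x) * G j x \<partial>haar) \<longlonglongrightarrow> c * measure haar A"
proof -
  interpret prob_space haar by (rule prob_space_haar)
  define V where "V = {f :: point \<Rightarrow> real. f \<in> borel_measurable borel_points \<and> (\<exists>B. \<forall>x\<in>points. \<bar>f x\<bar> \<le> B)
      \<and> (\<lambda>j. \<integral>x. f (T j x) * G j x \<partial>haar) \<longlonglongrightarrow> c * (\<integral>x. f x \<partial>haar)}"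
  have T_in: "T j x \<in> points" if "x \<in> points" for j x
    using measurable_space[OF T[of j], of x] that by simp
  have int1: "integrable haar (\<lambda>x. f (T j x) * G j x)"
    if "f \<in> borel_measurable borel_points" "\<And>x. x \<in> points \<Longrightarrow> \<bar>f x\<bar> \<le> B" for f j B
  proof (rule integrable_haar_bounded[where B = B])
    show "(\<lambda>x. f (T j x) * G j x) \<in> borel_measurable borel_points"
      by (intro borel_measurable_times G(1) measurable_compose[OF T that(1)])
    fix x assume x: "x \<in> points"
    have "\<bar>f (T j x)\<bar> * \<bar>G j x\<bar> \<le> B * 1"
      using that(2)[OF T_in[OF x, of j]] G(2)[OF x, of j] by (intro mult_mono) auto
    then show "\<bar>f (T j x) * G j x\<bar> \<le> B" by (simp add: abs_mult)
  qed
  have V_meas: "f \<in> borel_measurable borel_points"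
    and V_bound: "\<exists>B. \<forall>x\<in>points. \<bar>f x\<bar> \<le> B"
    and V_lim: "(\<lambda>j. \<integral>x. f (T j x) * G j x \<partial>haar) \<longlonglongrightarrow> c * (\<integral>x. f x \<partial>haar)"
    if "f \<in> V" for f
    using that by (simp_all add: V_def)
  have V_char: "character (\<lambda>n. n) S \<in> V" if "finite S" for S
    unfolding V_def using char[OF that] measurable_character by (auto intro: exI[of _ 1])
  have V_add: "(\<lambda>x. f x + g x) \<in> V" if fV: "f \<in> V" and gV: "g \<in> V" for f g
  proof -
    obtain B where B: "\<forall>x\<in>points. \<bar>f x\<bar> \<le> B" using V_bound[OF fV] by blast
    note f = V_meas[OF fV] bspec[OF B] V_lim[OF fV]
    obtain C where C: "\<forall>x\<in>points. \<bar>g x\<bar> \<le> C" using V_bound[OF gV] by blast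
    note g = V_meas[OF gV] bspec[OF C] V_lim[OF gV]
    have "(\<integral>x. (f (T j x) + g (T j x)) * G j x \<partial>haar) = (\<integral>x. f (T j x) * G j x \<partial>haar) + (\<integral>x. g (T j x) * G j x \<partial>haar)" for j
      unfolding distrib_right
      by (intro Bochner_Integration.integral_add int1[OF f(1,2)] int1[OF g(1,2)])
    moreover have "(\<integral>x. f x + g x \<partial>haar) = (\<integral>x. f x \<partial>haar) + (\<integral>x. g x \<partial>haar)"
      by (intro Bochner_Integration.integral_add integrable_haar_bounded[OF f(1,2)] integrable_haar_bounded[OF g(1,2)])
    moreover have "\<bar>f x + g x\<bar> \<le> B + C" if "x \<in> points" for x
      using f(2)[OF that] g(2)[OF that] by linarith
    ultimately show ?thesis
      unfolding V_def using f(1) g(1) tendsto_add[OF f(3) g(3)] by (auto simp: distrib_left)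
  qed
  have V_scale: "(\<lambda>x. a * f x) \<in> V" if fV: "f \<in> V" for f a
  proof -
    obtain B where B: "\<forall>x\<in>points. \<bar>f x\<bar> \<le> B" using V_bound[OF fV] by blast
    note f = V_meas[OF fV] bspec[OF B] V_lim[OF fV]
    have "\<bar>a * f x\<bar> \<le> \<bar>a\<bar> * B" if "x \<in> points" for x
      unfolding abs_mult by (intro mult_left_mono f(2) that) simp
    then show ?thesis
      unfolding V_def using f(1) tendsto_mult_left[OF f(3), of a] by (auto simp: mult.assoc mult.left_commute)
  qed
  have V_cong: "f \<in> V" if "g \<in> V" "\<And>x. x \<in> points \<Longrightarrow> f x = g x" for f g
  proof -
    have "(\<integral>x. f (T j x) * G j x \<partial>haar) = (\<integral>x. g (T j x) * G j x \<partial>haar)" for j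
      by (rule Bochner_Integration.integral_cong) (simp_all add: that T_in)
    moreover have "(\<integral>x. f x \<partial>haar) = (\<integral>x. g x \<partial>haar)"
      by (rule Bochner_Integration.integral_cong) (simp_all add: that)
    moreover have "f \<in> borel_measurable borel_points \<longleftrightarrow> g \<in> borel_measurable borel_points"
      by (rule measurable_cong) (simp add: that)
    ultimately show ?thesis using that unfolding V_def by simp
  qed
  have V_one: "(\<lambda>_. 1) \<in> V" using V_char[of "{}"] by (simp add: character_def[abs_def])
  have V_empty: "indicator {} \<in> V"
    by (rule V_cong[OF V_scale[OF V_one, of 0]]) simp
  have V_cyl: "indicator (cylinder F c') \<in> V" if "finite F" for F c'
  proof (rule cylinder_cases[OF that, of c'])
    assume "cylinder F c' = {}"
    then show ?thesis using V_empty by simp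
  next
    assume "\<And>n. n \<in> F \<Longrightarrow> c' n \<in> {0, 1}"
    then show ?thesis
      using cylinder_in_span[of V F "\<lambda>n. parity_sign (c' n)"] V_char V_add V_scale that
      by (intro V_cong[OF _ indicator_cylinder[OF that]]) blast+
  qed
  have ind_meas: "(indicator A :: point \<Rightarrow> real) \<in> borel_measurable borel_points" if "A \<in> sets borel_points" for A
    using that by simp
  have ind_int: "integrable haar (\<lambda>x. indicator A (T j x) * G j x)" if "A \<in> sets borel_points" for A j
    by (rule int1[of "indicator A" 1 j]) (use ind_meas[OF that] in \<open>auto simp: indicator_def\<close>)
  have "indicator A \<in> V"
  proof (rule sigma_sets_induct_disjoint[OF Int_stable_cylinders, of points])
    show "{cylinder F c |F c. finite F} \<subseteq> Pow points" by (auto simp: cylinder_def)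
    show "A \<in> sigma_sets points {cylinder F c |F c. finite F}" using A sets_borel_points by simp
    show "indicator B \<in> V" if "B \<in> {cylinder F c |F c. finite F}" for B using that V_cyl by auto
    show "indicator {} \<in> V" by (rule V_empty)
    show "indicator (points - B) \<in> V" if "indicator B \<in> V" for B
      by (rule V_cong[OF V_add[OF V_one V_scale[OF that, of "- 1"]]]) (simp add: indicator_def)
    fix B :: "nat \<Rightarrow> point set"
    assume disj: "disjoint_family B" and "range B \<subseteq> sigma_sets points {cylinder F c |F c. finite F}"
      and BV: "\<And>i. indicator (B i) \<in> V"
    then have B: "B i \<in> sets borel_points" for i by (auto simp: sets_borel_points)
    then have BU: "(\<Union>i. B i) \<in> sets borel_points" by auto
    have sums_meas: "(\<lambda>i. measure haar (B i)) sums measure haar (\<Union>i. B i)"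
      using B disj by (intro finite_measure_UNION) (auto simp: sets_haar)
    have lim: "(\<lambda>j. \<integral>x. indicator (B i) (T j x) * G j x \<partial>haar) \<longlonglongrightarrow> c * measure haar (B i)" for i
      using BV[of i] B[of i] sets.sets_into_space[OF B[of i]] unfolding V_def by (simp add: sets_haar Int_absorb2)
    have norm_bound: "(\<integral>x. norm (indicator (B i) (T j x) * G j x) \<partial>haar) \<le> measure haar (B i)" for i j
    proof -
      have "(\<integral>x. norm (indicator (B i) (T j x) * G j x) \<partial>haar) \<le> (\<integral>x. indicator (T j -` B i \<inter> points) x \<partial>haar)"
      proof (rule integral_mono)
        show "integrable haar (\<lambda>x. norm (indicator (B i) (T j x) * G j x))"
          by (intro integrable_norm ind_int B)
        show "integrable haar (indicator (T j -` B i \<inter> points) :: point \<Rightarrow> real)"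
          using measurable_sets[OF T B, of j i]
          by (intro integrable_haar_bounded[where B = 1]) (auto simp: indicator_def)
        show "norm (indicator (B i) (T j x) * G j x) \<le> indicator (T j -` B i \<inter> points) x" if "x \<in> space haar" for x
          using that G(2)[of x j] by (simp add: indicator_def)
      qed
      also have "\<dots> = measure haar (T j -` B i \<inter> points)"
        using measurable_sets[OF T B, of j i] by (simp add: sets_haar)
      also have "\<dots> \<le> measure haar (B i)" by (rule inv[OF B])
      finally show ?thesis .
    qed
    have bound: "norm (\<integral>x. indicator (B i) (T j x) * G j x \<partial>haar) \<le> measure haar (B i)" for i j
      using integral_norm_bound norm_bound by (rule order_trans)
    have series: "(\<Sum>i. \<integral>x. indicator (B i) (T j x) * G j x \<partial>haar) = (\<integral>x. indicator (\<Union>i. B i) (T j x) * G j x \<partial>haar)" for j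
    proof -
      have "(\<lambda>i. \<integral>x. indicator (B i) (T j x) * G j x \<partial>haar) sums (\<integral>x. (\<Sum>i. indicator (B i) (T j x) * G j x) \<partial>haar)"
      proof (rule sums_integral)
        show "integrable haar (\<lambda>x. indicator (B i) (T j x) * G j x)" for i
          by (rule ind_int[OF B])
        have ind: "(\<lambda>i. indicator (B i) y :: real) sums indicator (\<Union>i. B i) y" for y
          by (rule indicator_sums) (use disj in \<open>auto simp: disjoint_family_on_def\<close>)
        show "AE x in haar. summable (\<lambda>i. norm (indicator (B i) (T j x) * G j x))"
          using summable_mult2[OF sums_summable[OF ind]] by (simp add: abs_mult)
        show "summable (\<lambda>i. \<integral>x. norm (indicator (B i) (T j x) * G j x) \<partial>haar)"
          by (rule summable_comparison_test'[OF sums_summable[OF sums_meas], of 0])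
             (use norm_bound in \<open>simp add: integral_nonneg\<close>)
      qed
      moreover have "(\<Sum>i. indicator (B i) (T j x) * G j x) = indicator (\<Union>i. B i) (T j x) * G j x" for x
        using sums_mult2[OF indicator_sums[of B "T j x"], of "G j x"] disj
        by (auto simp: disjoint_family_on_def intro!: sums_unique[symmetric])
      ultimately show ?thesis by (simp add: sums_iff)
    qed
    have "(\<lambda>j. \<Sum>i. \<integral>x. indicator (B i) (T j x) * G j x \<partial>haar) \<longlonglongrightarrow> (\<Sum>i. c * measure haar (B i))"
      by (rule tannerys_theorem[OF lim, where M = "\<lambda>i. measure haar (B i)", THEN conjunct2, THEN conjunct2])
         (use bound sums_meas in \<open>auto simp: sums_iff case_prod_unfold\<close>)
    also have "(\<Sum>i. c * measure haar (B i)) = c * measure haar (\<Union>i. B i)"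
      using sums_mult[OF sums_meas, of c] by (simp add: sums_iff)
    finally have "(\<lambda>j. \<integral>x. indicator (\<Union>i. B i) (T j x) * G j x \<partial>haar) \<longlonglongrightarrow> c * measure haar (\<Union>i. B i)"
      by (simp only: series)
    then show "indicator (\<Union>i. B i) \<in> V"
      using BU sets.sets_into_space[OF BU] unfolding V_def
      by (auto simp: sets_haar Int_absorb2 intro!: exI[of _ 1])
  qed
  then show ?thesis
    using A sets.sets_into_space[OF A] unfolding V_def by (simp add: sets_haar Int_absorb2)
qed

lemma integral_character_shift:
  assumes "finite S"
  shows "(\<integral>x. character (\<lambda>n. n) S (shift m x) \<partial>haar) = (\<integral>x. character (\<lambda>n. n) S x \<partial>haar)"
proof -
  have "character (\<lambda>n. n) S (shift m x) = character (\<lambda>n. n + m) S x" for x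
    by (simp add: character_def shift_def)
  moreover have "(\<Sum>n\<in>S. \<phi> (n + m)) = 0 \<longleftrightarrow> (\<Sum>n\<in>S. \<phi> n) = 0"
    using \<phi>_nonzero[of m] by (simp add: \<phi>_add flip: sum_distrib_right)
  ultimately show ?thesis
    using integral_character[OF assms, of "\<lambda>n. n + m"] integral_character[OF assms, of "\<lambda>n. n"] by simp
qed

section \<open>Mixing from characters to Borel sets\<close>

text \<open>
  Shifting multiplies a ring element by a unit, so the integrals of characters do not change, and these
  determine the measures of cylinders.
\<close>

lemma haar_shift: "distr haar borel_points (shift m) = haar"
proof (rule measure_eqI_generator_eq[OF Int_stable_cylinders, where \<Omega> = points and A = "\<lambda>_. points"])
  interpret prob_space haar by (rule prob_space_haar)
  show "{cylinder F c |F c. finite F} \<subseteq> Pow points" by (auto simp: cylinder_def)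
  show "sets (distr haar borel_points (shift m)) = sigma_sets points {cylinder F c |F c. finite F}"
    "sets haar = sigma_sets points {cylinder F c |F c. finite F}"
    by (simp_all add: sets_borel_points sets_haar)
  have "points = cylinder {} c" for c by (simp add: cylinder_def)
  then show "range (\<lambda>_. points) \<subseteq> {cylinder F c |F c. finite F}" by blast
  show "(\<Union>i::nat. points) = points" by simp
  have ms: "shift m \<in> measurable haar borel_points" by (simp add: measurable_haar measurable_shift)
  show "emeasure (distr haar borel_points (shift m)) points \<noteq> \<infinity>"
    using emeasure_finite by (simp add: emeasure_distr[OF ms] sets_borel_points sigma_sets_top)
  fix C assume "C \<in> {cylinder F c |F c. finite F}"
  then obtain F c where C: "C = cylinder F c" "finite F" by auto
  define V where "V = {f :: point \<Rightarrow> real. f \<in> borel_measurable borel_points \<and> integrable haar f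
      \<and> integrable haar (\<lambda>x. f (shift m x)) \<and> (\<integral>x. f (shift m x) \<partial>haar) = (\<integral>x. f x \<partial>haar)}"
  have V_char: "character (\<lambda>n. n) S \<in> V" if "finite S" for S
    unfolding V_def using integral_character_shift[OF that] measurable_character measurable_compose[OF measurable_shift[of m] measurable_character[of "\<lambda>n. n" S]]
    by (auto intro!: integrable_haar_bounded[where B = 1])
  have V_add: "(\<lambda>x. f x + g x) \<in> V" if "f \<in> V" "g \<in> V" for f g
    using that unfolding V_def by auto
  have V_scale: "(\<lambda>x. a * f x) \<in> V" if "f \<in> V" for f a
    using that unfolding V_def by auto
  show "emeasure (distr haar borel_points (shift m)) C = emeasure haar C"
  proof (rule cylinder_cases[OF C(2), of c])
    assume "cylinder F c = {}"
    then show ?thesis by (simp add: C)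
  next
    assume c01: "\<And>n. n \<in> F \<Longrightarrow> c n \<in> {0, 1}"
    let ?p = "\<lambda>x. \<Prod>n\<in>F. (1 + parity_sign (c n) * parity_sign (x n)) / 2"
    have "?p \<in> V"
      by (rule cylinder_in_span[OF V_char V_add V_scale C(2)])
    then have eq: "(\<integral>x. ?p (shift m x) \<partial>haar) = (\<integral>x. ?p x \<partial>haar)" by (simp only: V_def mem_Collect_eq)
    have Cs: "C \<in> sets borel_points" using C cylinder_in_sets by simp
    have "measure (distr haar borel_points (shift m)) C = measure haar (shift m -` C \<inter> points)"
      using measure_distr[OF ms Cs] by simp
    also have "\<dots> = (\<integral>x. indicator (shift m -` C \<inter> points) x \<partial>haar)"
      using measurable_sets[OF measurable_shift Cs] by (simp add: sets_haar)
    also have "\<dots> = (\<integral>x. ?p (shift m x) \<partial>haar)"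
    proof (rule Bochner_Integration.integral_cong[OF refl])
      fix x assume "x \<in> space haar"
      then show "indicator (shift m -` C \<inter> points) x = ?p (shift m x)"
        using indicator_cylinder[OF C(2) shift_in, of x c m] c01 by (simp add: C(1) indicator_def)
    qed
    also have "\<dots> = (\<integral>x. indicator C x \<partial>haar)"
      unfolding eq by (rule Bochner_Integration.integral_cong[OF refl])
        (use indicator_cylinder[OF C(2)] c01 in \<open>simp add: C(1)\<close>)
    also have "\<dots> = measure haar C"
      using Cs sets.sets_into_space[OF Cs] by (simp add: sets_haar Int_absorb2)
    finally have eq: "measure (distr haar borel_points (shift m)) C = measure haar C" .
    interpret D: prob_space "distr haar borel_points (shift m)" by (rule prob_space_distr[OF ms])
    show ?thesis by (simp add: D.emeasure_eq_measure emeasure_eq_measure eq)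
  qed
qed

text \<open>
  A product of shifted characters is again a character, belonging to the sum of the shifted ring
  elements. The factors that belong to the zero element are constantly \<open>1\<close> and drop out; if any
  others remain, both the integral (eventually) and the product of the integrals are zero.
\<close>

lemma character_mixing:
  fixes n :: "nat \<Rightarrow> nat \<Rightarrow> int \<times> int" and S :: "nat \<Rightarrow> (int \<times> int) set"
  assumes S: "\<And>s. s \<in> R \<Longrightarrow> finite (S s)" and "finite R"
    and indep: "\<And>I. I \<subseteq> R \<Longrightarrow> I \<noteq> {} \<Longrightarrow> (\<And>s. s \<in> I \<Longrightarrow> (\<Sum>m\<in>S s. \<phi> m) \<noteq> 0) \<Longrightarrow>
      \<forall>\<^sub>F j in sequentially. (\<Sum>s\<in>I. \<Sum>m\<in>S s. \<phi> (n s j + m)) \<noteq> 0"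
  shows "(\<lambda>j. \<integral>x. (\<Prod>s\<in>R. character (\<lambda>n. n) (S s) (shift (n s j) x)) \<partial>haar)
    \<longlonglongrightarrow> (\<Prod>s\<in>R. \<integral>x. character (\<lambda>n. n) (S s) x \<partial>haar)"
proof -
  \<comment> \<open>the slots whose character is nontrivial on the group\<close>
  define I where "I = {s \<in> R. (\<Sum>m\<in>S s. \<phi> m) \<noteq> 0}"
  have fin: "finite I" "\<And>s. s \<in> I \<Longrightarrow> finite (S s)" using S \<open>finite R\<close> by (auto simp: I_def)
  let ?f = "\<lambda>j (s, m). n s j + m"
  have char: "(\<Prod>s\<in>R. character (\<lambda>n. n) (S s) (shift (n s j) x)) = character (?f j) (Sigma I S) x"
    if "x \<in> points" for x j
  proof -
    have "character (\<lambda>n. n) (S s) (shift (n s j) x) = 1" if "s \<in> R - I" for s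
    proof -
      have "(\<Sum>m\<in>S s. \<phi> m) = 0" using that by (simp add: I_def)
      then have "even (\<Sum>m\<in>S s. shift (n s j) x m)"
        using shift_in[OF \<open>x \<in> points\<close>] S that by (intro points_even_family) auto
      then show ?thesis by (simp add: character_def parity_sign_def)
    qed
    then have "(\<Prod>s\<in>R. character (\<lambda>n. n) (S s) (shift (n s j) x)) = (\<Prod>s\<in>I. character (\<lambda>n. n) (S s) (shift (n s j) x))"
      using \<open>finite R\<close> by (intro prod.mono_neutral_right) (auto simp: I_def)
    also have "\<dots> = (\<Prod>s\<in>I. \<Prod>m\<in>S s. parity_sign (x (n s j + m)))"
      by (simp add: character_def shift_def parity_sign_sum add.commute)
    also have "\<dots> = character (?f j) (Sigma I S) x"
      using fin by (simp add: character_def parity_sign_sum prod.Sigma case_prod_unfold)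
    finally show ?thesis .
  qed
  have int: "(\<integral>x. (\<Prod>s\<in>R. character (\<lambda>n. n) (S s) (shift (n s j) x)) \<partial>haar)
      = (if (\<Sum>s\<in>I. \<Sum>m\<in>S s. \<phi> (n s j + m)) = 0 then 1 else 0)" for j
  proof -
    have "(\<integral>x. (\<Prod>s\<in>R. character (\<lambda>n. n) (S s) (shift (n s j) x)) \<partial>haar) = (\<integral>x. character (?f j) (Sigma I S) x \<partial>haar)"
      by (rule Bochner_Integration.integral_cong) (simp_all add: char)
    also have "\<dots> = (if (\<Sum>s\<in>I. \<Sum>m\<in>S s. \<phi> (n s j + m)) = 0 then 1 else 0)"
      using fin by (subst integral_character) (auto simp: sum.Sigma case_prod_unfold)
    finally show ?thesis .
  qed
  have prod: "(\<Prod>s\<in>R. \<integral>x. character (\<lambda>n. n) (S s) x \<partial>haar) = (if I = {} then 1 else 0)"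
    using \<open>finite R\<close> S by (auto simp: integral_character I_def intro!: prod.neutral prod_zero)
  show ?thesis
  proof (cases "I = {}")
    case True
    then show ?thesis unfolding int prod by simp
  next
    case False
    have "\<forall>\<^sub>F j in sequentially. (\<Sum>s\<in>I. \<Sum>m\<in>S s. \<phi> (n s j + m)) \<noteq> 0"
      using False by (intro indep) (auto simp: I_def)
    then have "\<forall>\<^sub>F j in sequentially. (if (\<Sum>s\<in>I. \<Sum>m\<in>S s. \<phi> (n s j + m)) = 0 then 1 else 0) = (0::real)"
      by eventually_elim simp
    then show ?thesis unfolding int prod using False by (simp add: tendsto_eventually)
  qed
qed

text \<open>
  Starting from characters in all slots, the slots in \<open>U\<close> are turned into indicators of the given sets one
  after the other.
\<close>

lemma mixing_of_order_if_independent: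
  assumes "r \<ge> 1" and indep: "\<And>I n S. I \<subseteq> {1..r} \<Longrightarrow> I \<noteq> {} \<Longrightarrow> (\<And>s. s \<in> I \<Longrightarrow> finite (S s)) \<Longrightarrow>
      (\<And>s. s \<in> I \<Longrightarrow> (\<Sum>m\<in>S s. \<phi> m) \<noteq> 0) \<Longrightarrow>
      (\<And>s t. s \<in> I \<Longrightarrow> t \<in> I \<Longrightarrow> s \<noteq> t \<Longrightarrow> filterlim (\<lambda>j::nat. n s j - n t j :: int \<times> int) cofinite sequentially) \<Longrightarrow>
      \<forall>\<^sub>F j in sequentially. (\<Sum>s\<in>I. \<Sum>m\<in>S s. \<phi> (n s j + m)) \<noteq> 0"
  shows "mixing_of_order r haar shift"
  unfolding mixing_of_order_def
proof (intro allI impI)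
  fix n :: "nat \<Rightarrow> nat \<Rightarrow> int \<times> int" and A :: "nat \<Rightarrow> point set"
  assume div: "\<forall>s\<in>{1..r}. \<forall>t\<in>{1..r}. s \<noteq> t \<longrightarrow> filterlim (\<lambda>j. n s j - n t j) cofinite sequentially"
    and A: "\<forall>s\<in>{1..r}. A s \<in> sets haar"
  interpret prob_space haar by (rule prob_space_haar)
  let ?R = "{1..r}"
  have main: "(\<lambda>j. \<integral>x. (\<Prod>s\<in>?R. g s (shift (n s j) x)) \<partial>haar) \<longlonglongrightarrow> (\<Prod>s\<in>?R. \<integral>x. g s x \<partial>haar)"
    if "U \<subseteq> ?R" "\<And>s. s \<in> U \<Longrightarrow> g s = indicator (A s)"
      "\<And>s. s \<in> ?R - U \<Longrightarrow> \<exists>S. finite S \<and> g s = character (\<lambda>n. n) S" for U and g :: "nat \<Rightarrow> point \<Rightarrow> real"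
  proof -
    have "finite U" using that(1) finite_subset by blast
    then show ?thesis using that
    proof (induction U arbitrary: g rule: finite_induct)
      case empty
      then obtain S where S: "\<And>s. s \<in> ?R \<Longrightarrow> finite (S s)" "\<And>s. s \<in> ?R \<Longrightarrow> g s = character (\<lambda>n. n) (S s)"
        by (metis Diff_empty)
      have "(\<lambda>j. \<integral>x. (\<Prod>s\<in>?R. character (\<lambda>n. n) (S s) (shift (n s j) x)) \<partial>haar)
          \<longlonglongrightarrow> (\<Prod>s\<in>?R. \<integral>x. character (\<lambda>n. n) (S s) x \<partial>haar)"
      proof (rule character_mixing)
        fix I assume "I \<subseteq> ?R" "I \<noteq> {}" "\<And>s. s \<in> I \<Longrightarrow> (\<Sum>m\<in>S s. \<phi> m) \<noteq> 0"
        then show "\<forall>\<^sub>F j in sequentially. (\<Sum>s\<in>I. \<Sum>m\<in>S s. \<phi> (n s j + m)) \<noteq> 0"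
          using S(1) div by (intro indep) blast+
      qed (use S in auto)
      then show ?case using S(2) by simp
    next
      case (insert u U)
      have u: "u \<in> ?R" and gu: "g u = indicator (A u)" using insert.prems by auto
      have Au: "A u \<in> sets borel_points" using A u by (simp add: sets_haar)
      have g_meas: "g s \<in> borel_measurable borel_points" and g_le: "\<bar>g s x\<bar> \<le> 1" if "s \<in> ?R" for s x
      proof -
        have "g s = indicator (A s) \<or> (\<exists>S. g s = character (\<lambda>n. n) S)"
          using insert.prems(2,3)[of s] that by blast
        then show "g s \<in> borel_measurable borel_points" "\<bar>g s x\<bar> \<le> 1"
          using A that measurable_character by (auto simp: sets_haar indicator_def)
      qed
      let ?G = "\<lambda>j x. \<Prod>s\<in>?R - {u}. g s (shift (n s j) x)"
      let ?c = "\<Prod>s\<in>?R - {u}. \<integral>x. g s x \<partial>haar"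
      have split: "(\<Prod>s\<in>?R. h s) = h u * (\<Prod>s\<in>?R - {u}. h s)" for h :: "nat \<Rightarrow> real"
        using u by (intro prod.remove) auto
      have "(\<lambda>j. \<integral>x. indicator (A u) (shift (n u j) x) * ?G j x \<partial>haar) \<longlonglongrightarrow> ?c * measure haar (A u)"
      proof (rule indicator_limit_from_characters)
        show "shift (n u j) \<in> measurable borel_points borel_points" for j by (rule measurable_shift)
        show "measure haar (shift (n u j) -` B \<inter> points) \<le> measure haar B" if "B \<in> sets borel_points" for j B
          using measure_distr[of "shift (n u j)" haar borel_points B] that
          by (simp add: measurable_haar measurable_shift haar_shift)
        show "?G j \<in> borel_measurable borel_points" for j
          by (intro borel_measurable_prod measurable_compose[OF measurable_shift g_meas]) auto
        show "\<bar>?G j x\<bar> \<le> 1" if "x \<in> points" for j x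
          unfolding abs_prod by (rule prod_le_1) (use g_le in auto)
        show "A u \<in> sets borel_points" by (rule Au)
        fix S :: "(int \<times> int) set" assume S: "finite S"
        let ?g = "g(u := character (\<lambda>n. n) S)"
        have "(\<lambda>j. \<integral>x. (\<Prod>s\<in>?R. ?g s (shift (n s j) x)) \<partial>haar) \<longlonglongrightarrow> (\<Prod>s\<in>?R. \<integral>x. ?g s x \<partial>haar)"
          using insert.prems insert.hyps S by (intro insert.IH) auto
        then show "(\<lambda>j. \<integral>x. character (\<lambda>n. n) S (shift (n u j) x) * ?G j x \<partial>haar)
            \<longlonglongrightarrow> ?c * (\<integral>x. character (\<lambda>n. n) S x \<partial>haar)"
          unfolding split by (simp add: mult.commute)
      qed
      then show ?case
        unfolding split gu using Au sets.sets_into_space[OF Au] by (simp add: sets_haar Int_absorb2 mult.commute)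
    qed
  qed
  have "(\<lambda>j. \<integral>x. (\<Prod>s\<in>?R. indicat_real (A s) (shift (n s j) x)) \<partial>haar) \<longlonglongrightarrow> (\<Prod>s\<in>?R. \<integral>x. indicat_real (A s) x \<partial>haar)"
    by (rule main[of ?R "\<lambda>s. indicat_real (A s)"]) auto
  moreover have "(\<integral>x. indicat_real (A s) x \<partial>haar) = measure haar (A s)" if "s \<in> ?R" for s
    using A that sets.sets_into_space[of "A s" haar] by (simp add: Int_absorb2)
  moreover have "(\<integral>x. (\<Prod>s\<in>?R. indicat_real (A s) (shift (n s j) x)) \<partial>haar) = measure haar (\<Inter>s\<in>?R. shift (- n s j) ` A s)" for j
  proof -
    have A_sub: "A s \<subseteq> points" if "s \<in> ?R" for s using A that sets.sets_into_space[of "A s" haar] by simp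
    have eq: "(\<Inter>s\<in>?R. shift (- n s j) ` A s) = (\<Inter>s\<in>?R. {x \<in> points. shift (n s j) x \<in> A s})"
      by (rule INF_cong[OF refl]) (rule shift_image[OF A_sub])
    have meas: "{x \<in> points. shift (n s j) x \<in> A s} \<in> sets haar" if "s \<in> ?R" for s
      using measurable_sets[OF measurable_shift, of "A s" "n s j"] A that
      by (simp add: sets_haar vimage_def Int_def conj_commute)
    have in_sets: "(\<Inter>s\<in>?R. {x \<in> points. shift (n s j) x \<in> A s}) \<in> sets haar"
      using \<open>r \<ge> 1\<close> meas by (intro sets.finite_INT) auto
    have "(\<integral>x. (\<Prod>s\<in>?R. indicat_real (A s) (shift (n s j) x)) \<partial>haar)
        = (\<integral>x. indicat_real (\<Inter>s\<in>?R. {x \<in> points. shift (n s j) x \<in> A s}) x \<partial>haar)"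
    proof (rule Bochner_Integration.integral_cong[OF refl])
      fix x assume "x \<in> space haar"
      then show "(\<Prod>s\<in>?R. indicat_real (A s) (shift (n s j) x)) = (indicat_real (\<Inter>s\<in>?R. {x \<in> points. shift (n s j) x \<in> A s}) x )"
        using \<open>r \<ge> 1\<close> by (auto simp: indicator_def intro!: prod_zero)
    qed
    also have "\<dots> = measure haar (\<Inter>s\<in>?R. {x \<in> points. shift (n s j) x \<in> A s})"
      using sets.sets_into_space[OF in_sets] in_sets by (simp add: Int_absorb2)
    finally show ?thesis unfolding eq .
  qed
  ultimately show "(\<lambda>j. measure haar (\<Inter>s\<in>?R. shift (- n s j) ` A s)) \<longlonglongrightarrow> (\<Prod>s\<in>?R. measure haar (A s))"
    by simp
qed

section \<open>A sequence that does not mix\<close>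

text \<open>
  By Frobenius the relation between the monomials persists after scaling all exponents by \<open>2^j\<close>. So for
  every point of the group the number of ones at the scaled positions is even, and the event that the
  point is \<open>1\<close> at the last of them and \<open>0\<close> at the others is empty, although the product of
  the probabilities is positive.
\<close>

lemma not_mixing_of_order_if_relation:
  fixes p :: "nat \<Rightarrow> int \<times> int"
  assumes inj: "inj_on p {1..r}" and "r \<ge> 1" and rel: "(\<Sum>s\<in>{1..r}. \<phi> (p s)) = 0"
  shows "\<not> mixing_of_order r haar shift"
proof
  assume mix: "mixing_of_order r haar shift"
  interpret prob_space haar by (rule prob_space_haar)
  let ?R = "{1..r}"
  define scale :: "nat \<Rightarrow> int \<times> int \<Rightarrow> int \<times> int" where "scale j m = (2 ^ j * fst m, 2 ^ j * snd m)" for j m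
  define C where "C b = {x \<in> points. x 0 = b}" for b
  define A where "A s = C (if s = r then 1 else 0)" for s
  have pow_nat: "\<phi> (int t * a, int t * b) = \<phi> (a, b) ^ t" for t a b
  proof (induction t)
    case 0
    then show ?case using \<phi>_zero by (simp add: zero_prod_def)
  next
    case (Suc t)
    then show ?case using \<phi>_add[of "(a, b)" "(int t * a, int t * b)"] by (simp add: algebra_simps)
  qed
  have scale: "\<phi> (scale j m) = \<phi> m ^ (2 ^ j)" for j m
    using pow_nat[of "2 ^ j" "fst m" "snd m"] by (simp add: scale_def)
  have "(\<Sum>s\<in>?R. \<phi> (scale j (p s))) = 0" for j
    using rel by (simp add: scale flip: fls_bit_sum_power)
  then have even: "even (\<Sum>s\<in>?R. x (scale j (p s)))" if "x \<in> points" for x j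
    using that by (intro points_even_family) auto
  have C_sets: "C b \<in> sets haar" for b
  proof -
    have "C b = cylinder {0} (\<lambda>_. b)" by (auto simp: C_def cylinder_def)
    then show ?thesis by (simp add: sets_haar cylinder_in_sets)
  qed
  have C_meas: "measure haar (C b) > 0" if "b \<in> {0, 1}" for b
  proof -
    have "measure haar (C 0) = measure haar (C 1)"
    proof -
      obtain y where y: "y \<in> points" "odd (\<Sum>a\<in>{0::int \<times> int}. y a)"
        using points_separate[of "\<lambda>n. n" "{0}"] \<phi>_zero by auto
      then have y0: "y 0 = 1" using points_range[of y 0] by auto
      have "point_add y -` C 0 \<inter> points = C 1"
      proof (intro equalityI subsetI)
        fix x assume "x \<in> point_add y -` C 0 \<inter> points"
        then show "x \<in> C 1" using y0 points_range[of x 0] by (auto simp: C_def point_add_def)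
      next
        fix x assume "x \<in> C 1"
        then show "x \<in> point_add y -` C 0 \<inter> points"
          using y0 point_add_in[OF y(1)] by (auto simp: C_def point_add_def)
      qed
      then have "measure (distr haar borel_points (point_add y)) (C 0) = measure haar (C 1)"
        using measurable_point_add[OF y(1)] C_sets by (simp add: measure_distr measurable_haar sets_haar)
      then show ?thesis by (simp add: haar_translate[OF y(1)])
    qed
    moreover have "measure haar (C 0) + measure haar (C 1) = measure haar (C 0 \<union> C 1)"
      using C_sets by (intro finite_measure_Union[symmetric]) (auto simp: C_def)
    moreover have "C 0 \<union> C 1 = space haar" using points_range[of _ 0] by (auto simp: C_def)
    ultimately show ?thesis using prob_space that by auto
  qed
  have "filterlim (\<lambda>j. scale j (p s) - scale j (p t)) cofinite sequentially" if "s \<in> ?R" "t \<in> ?R" "s \<noteq> t" for s t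
  proof -
    let ?d = "p s - p t"
    have "?d \<noteq> 0" using inj that by (auto dest: inj_onD)
    then have "fst ?d \<noteq> 0 \<or> snd ?d \<noteq> 0" by (auto simp: prod_eq_iff)
    then have "inj (\<lambda>j. scale j ?d)" by (auto simp: scale_def intro!: injI)
    moreover have "scale j (p s) - scale j (p t) = scale j ?d" for j
      by (simp add: scale_def prod_eq_iff algebra_simps)
    ultimately have inj: "inj (\<lambda>j. scale j (p s) - scale j (p t))" by simp
    show ?thesis
      unfolding filterlim_iff eventually_cofinite cofinite_eq_sequentially[symmetric]
    proof (intro allI impI)
      fix P :: "int \<times> int \<Rightarrow> bool" assume "finite {x. \<not> P x}"
      from finite_vimageI[OF this inj] show "finite {j. \<not> P (scale j (p s) - scale j (p t))}"
        by (simp add: vimage_def)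
    qed
  qed
  then have "(\<lambda>j. measure haar (\<Inter>s\<in>?R. shift (- scale j (p s)) ` A s)) \<longlonglongrightarrow> (\<Prod>s\<in>?R. measure haar (A s))"
    using mix[unfolded mixing_of_order_def, THEN spec, of "\<lambda>s j. scale j (p s)", THEN spec, of A] C_sets
    by (simp add: A_def)
  moreover have "(\<Inter>s\<in>?R. shift (- scale j (p s)) ` A s) = {}" for j
  proof (rule ccontr)
    assume "(\<Inter>s\<in>?R. shift (- scale j (p s)) ` A s) \<noteq> {}"
    then obtain x where "x \<in> (\<Inter>s\<in>?R. shift (- scale j (p s)) ` A s)" by blast
    then have x: "x \<in> shift (- scale j (p s)) ` A s" if "s \<in> ?R" for s using that by (rule INT_D)
    have "A s \<subseteq> points" for s by (auto simp: A_def C_def)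
    then have x': "x \<in> points" "x (scale j (p s)) = (if s = r then 1 else 0)" if "s \<in> ?R" for s
      using x[OF that] shift_image[of "A s" "scale j (p s)"] by (auto simp: A_def C_def shift_def)
    then have "(\<Sum>s\<in>?R. x (scale j (p s))) = (\<Sum>s\<in>?R. if s = r then 1 else 0)"
      by (intro sum.cong) auto
    also have "\<dots> = 1" using \<open>r \<ge> 1\<close> by simp
    finally show False using even[of x j] x'(1)[of r] \<open>r \<ge> 1\<close> by simp
  qed
  ultimately have "(\<lambda>j::nat. 0::real) \<longlonglongrightarrow> (\<Prod>s\<in>?R. measure haar (A s))" by simp
  then have "(\<Prod>s\<in>?R. measure haar (A s)) = 0" using LIMSEQ_const_iff by metis
  moreover have "(\<Prod>s\<in>?R. measure haar (A s)) > 0"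
    by (intro prod_pos) (auto simp: A_def intro: C_meas)
  ultimately show False by (simp only: less_irrefl)
qed

end

theorem mainTheorem3:
  fixes k :: nat
  assumes "k \<ge> 1"
  shows "\<exists>(G :: point monoid) (T :: point topology) (\<alpha> :: int \<times> int \<Rightarrow> point \<Rightarrow> point)
           (\<mu> :: point measure).
           algebraic_Z2_action G T \<alpha> \<and> haar_probability G T \<mu> \<and>
           mixing_of_order k \<mu> \<alpha> \<and> \<not> mixing_of_order (k + 1) \<mu> \<alpha>"
proof -
  have "0 < k" using assms by simp
  then obtain v where v: "laurent_eval v (mixing_poly k) = 0" "v \<noteq> 0"
    by (rule mixing_poly_root)
  interpret dual_system "monomial v"
    by unfold_locales (simp_all add: monomial_add monomial_zero v)
  have "mixing_of_order k haar shift"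
  proof (rule mixing_of_order_if_independent[OF assms])
    fix I :: "nat set" and n :: "nat \<Rightarrow> nat \<Rightarrow> int \<times> int" and S :: "nat \<Rightarrow> (int \<times> int) set"
    assume I: "I \<subseteq> {1..k}" "I \<noteq> {}" and S: "\<And>s. s \<in> I \<Longrightarrow> finite (S s)"
        "\<And>s. s \<in> I \<Longrightarrow> (\<Sum>m\<in>S s. monomial v m) \<noteq> 0"
      and div: "\<And>s t. s \<in> I \<Longrightarrow> t \<in> I \<Longrightarrow> s \<noteq> t \<Longrightarrow> filterlim (\<lambda>j. n s j - n t j) cofinite sequentially"
    have fin: "finite I" using I(1) finite_subset by blast
    have "card I \<le> k" using card_mono[OF _ I(1)] by simp
    then have "\<exists>N. \<forall>n. (\<forall>s\<in>I. \<forall>t\<in>I. s \<noteq> t \<longrightarrow> n s - n t \<notin> {-N..N} \<times> {-N..N})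
        \<longrightarrow> (\<Sum>s\<in>I. \<Sum>m\<in>S s. monomial v (n s + m)) \<noteq> 0"
      by (intro few_far_monomials_independent[OF assms v fin I(2)] S)
    then obtain N where N: "\<And>n. \<forall>s\<in>I. \<forall>t\<in>I. s \<noteq> t \<longrightarrow> n s - n t \<notin> {-N..N} \<times> {-N..N}
        \<Longrightarrow> (\<Sum>s\<in>I. \<Sum>m\<in>S s. monomial v (n s + m)) \<noteq> 0"
      by blast
    have "\<forall>\<^sub>F j in sequentially. n s j - n t j \<notin> {-N..N} \<times> {-N..N}" if "s \<in> I" "t \<in> I" "s \<noteq> t" for s t
      using filterlim_iff[THEN iffD1, OF div[OF that], rule_format, of "\<lambda>x. x \<notin> {-N..N} \<times> {-N..N}"]
      by (simp add: eventually_cofinite)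
    then have "\<forall>\<^sub>F j in sequentially. \<forall>s\<in>I. \<forall>t\<in>I. s \<noteq> t \<longrightarrow> n s j - n t j \<notin> {-N..N} \<times> {-N..N}"
      using fin by (auto simp: eventually_ball_finite_distrib)
    then show "\<forall>\<^sub>F j in sequentially. (\<Sum>s\<in>I. \<Sum>m\<in>S s. monomial v (n s j + m)) \<noteq> 0"
    proof eventually_elim
      case (elim j)
      show ?case by (rule N[of "\<lambda>s. n s j"]) (rule elim)
    qed
  qed
  moreover have "\<not> mixing_of_order (k + 1) haar shift"
  proof (rule not_mixing_of_order_if_relation[where p = "\<lambda>s. (int (expo k (s - 1)), int (s - 1))"])
    show "inj_on (\<lambda>s. (int (expo k (s - 1)), int (s - 1))) {1..k + 1}"
      by (rule inj_onI) auto
    have "(\<Sum>s\<in>{1..k + 1}. monomial v (int (expo k (s - 1)), int (s - 1))) = (\<Sum>j\<le>k. monomial v (int (expo k j), int j))"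
      by (rule sum.reindex_bij_witness[of _ Suc "\<lambda>s. s - 1"]) auto
    also have "\<dots> = laurent_eval v (mixing_poly k)"
      by (simp add: mixing_poly_def laurent_eval_sum laurent_eval_monom monomial_def)
    finally show "(\<Sum>s\<in>{1..k + 1}. monomial v (int (expo k (s - 1)), int (s - 1))) = 0"
      using v by simp
  qed simp
  ultimately show ?thesis
    using algebraic_Z2_action_shift haar_probability_haar by blast
qed

end
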